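(* Let $\mathcal{H}$ be a Hopf algebra over a field, with unit $1$, coproduct $\Delta$ and counit $\varepsilon$. If $\mathcal{F}\in\mathcal{H}\otimes\mathcal{H}$ is a twist, then the linear map $d_{\mathcal{F}}:\mathcal{H}\to\mathcal{H}\otimes\mathcal{H}$, $d_{\mathcal{F}}(a)=\mathcal{F}\Delta(a)$, satisfies the following conditions for all $a,b\in\mathcal{H}$ (with $d=d_{\mathcal{F}}$): (a) $d$ is coassociative, i.e. $(d\otimes \mathrm{id})\,d=(\mathrm{id}\otimes d)\,d$; (b) $d(ab)=d(a)\,\Delta(b)$; (c) $(\varepsilon\otimes \mathrm{id})\,d(a)=1\otimes a$ and $(\mathrm{id}\otimes\varepsilon)\,d(a)=a\otimes 1$. Conversely, if a linear map $d:\mathcal{H}\to\mathcal{H}\otimes\mathcal{H}$ satisfies (a), (b) and (c), then $\mathcal{F}=d(1)$ is a twist.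
   Context: A twist (universal twist element) of a Hopf algebra $\mathcal{H}$ is an element $\mathcal{F}\in\mathcal{H}\otimes\mathcal{H}$ satisfying the 2-cocycle condition $\mathcal{F}_{12}(\Delta\otimes \mathrm{id})(\mathcal{F})=\mathcal{F}_{23}(\mathrm{id}\otimes\Delta)(\mathcal{F})$ in $\mathcal{H}^{\otimes 3}$, where $\mathcal{F}_{12}=\mathcal{F}\otimes 1$ and $\mathcal{F}_{23}=1\otimes\mathcal{F}$, and the normalization $(\varepsilon\otimes \mathrm{id})\mathcal{F}=(\mathrm{id}\otimes\varepsilon)\mathcal{F}=1\otimes 1$. Invertibility of $\mathcal{F}$ is not part of this definition. In the normalization and in (c), the ground field is identified with its image in $\mathcal{H}$ in the factor to which $\varepsilon$ is applied (equivalently, $(\varepsilon\otimes\mathrm{id})d(a)=a=(\mathrm{id}\otimes\varepsilon)d(a)$ after $k\otimes\mathcal{H}\cong\mathcal{H}\cong\mathcal{H}\otimes k$). *)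

theory Defs
  imports "HOL-Algebra.Module" "HOL-Algebra.AbelCoset"
begin

section \<open>Linear maps and associative algebras\<close>

definition linear_maps ::
  "('k, 'r) ring_scheme \<Rightarrow> ('k, 'a, 'm) module_scheme \<Rightarrow> ('k, 'b, 'n) module_scheme \<Rightarrow> ('a \<Rightarrow> 'b) set"
  where "linear_maps R M N =
    {f \<in> carrier M \<rightarrow> carrier N.
      (\<forall>x\<in>carrier M. \<forall>y\<in>carrier M. f (x \<oplus>\<^bsub>M\<^esub> y) = f x \<oplus>\<^bsub>N\<^esub> f y) \<and>
      (\<forall>c\<in>carrier R. \<forall>x\<in>carrier M. f (c \<odot>\<^bsub>M\<^esub> x) = c \<odot>\<^bsub>N\<^esub> f x)}"

(* The locale algebra of HOL-Algebra is restricted to commutative algebras. *)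
locale assoc_algebra = module R A + ring A
  for R (structure) and A (structure) +
  assumes smult_mult_left:
      "\<lbrakk>c \<in> carrier R; x \<in> carrier A; y \<in> carrier A\<rbrakk> \<Longrightarrow>
        (c \<odot>\<^bsub>A\<^esub> x) \<otimes>\<^bsub>A\<^esub> y = c \<odot>\<^bsub>A\<^esub> (x \<otimes>\<^bsub>A\<^esub> y)"
    and smult_mult_right:
      "\<lbrakk>c \<in> carrier R; x \<in> carrier A; y \<in> carrier A\<rbrakk> \<Longrightarrow>
        x \<otimes>\<^bsub>A\<^esub> (c \<odot>\<^bsub>A\<^esub> y) = c \<odot>\<^bsub>A\<^esub> (x \<otimes>\<^bsub>A\<^esub> y)"


section \<open>Tensor products\<close>

text \<open>The tensor product over \<open>R\<close> is the free module on
  \<open>carrier M \<times> carrier N\<close> modulo the submodule generated by the bilinearity relations;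
  its elements are cosets.  Module records have fields for a multiplication and a unit,
  which are irrelevant to the module structure and are left undefined here.\<close>

definition free_module :: "('k, 'r) ring_scheme \<Rightarrow> 'x set \<Rightarrow> ('k, 'x \<Rightarrow> 'k) module"
  where "free_module R X =
    \<lparr> carrier = {u. (\<forall>p\<in>X. u p \<in> carrier R) \<and> (\<forall>p. p \<notin> X \<longrightarrow> u p = \<zero>\<^bsub>R\<^esub>) \<and> finite {p. u p \<noteq> \<zero>\<^bsub>R\<^esub>}},
      mult = undefined,
      one = undefined,
      zero = (\<lambda>p. \<zero>\<^bsub>R\<^esub>),
      add = (\<lambda>u v p. u p \<oplus>\<^bsub>R\<^esub> v p),
      smult = (\<lambda>c u p. c \<otimes>\<^bsub>R\<^esub> u p) \<rparr>"

definition free_gen :: "('k, 'r) ring_scheme \<Rightarrow> 'x \<Rightarrow> 'x \<Rightarrow> 'k"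
  where "free_gen R p = (\<lambda>q. if q = p then \<one>\<^bsub>R\<^esub> else \<zero>\<^bsub>R\<^esub>)"

definition tensor_relators ::
  "('k, 'r) ring_scheme \<Rightarrow> ('k, 'a, 'm) module_scheme \<Rightarrow> ('k, 'b, 'n) module_scheme \<Rightarrow> ('a \<times> 'b \<Rightarrow> 'k) set"
  where "tensor_relators R M N =
    (let F = free_module R (carrier M \<times> carrier N); g = (\<lambda>x y. free_gen R (x, y)) in
      {g (x \<oplus>\<^bsub>M\<^esub> x') y \<ominus>\<^bsub>F\<^esub> (g x y \<oplus>\<^bsub>F\<^esub> g x' y) | x x' y.
          x \<in> carrier M \<and> x' \<in> carrier M \<and> y \<in> carrier N} \<union>
      {g x (y \<oplus>\<^bsub>N\<^esub> y') \<ominus>\<^bsub>F\<^esub> (g x y \<oplus>\<^bsub>F\<^esub> g x y') | x y y'.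
          x \<in> carrier M \<and> y \<in> carrier N \<and> y' \<in> carrier N} \<union>
      {g (c \<odot>\<^bsub>M\<^esub> x) y \<ominus>\<^bsub>F\<^esub> (c \<odot>\<^bsub>F\<^esub> g x y) | c x y.
          c \<in> carrier R \<and> x \<in> carrier M \<and> y \<in> carrier N} \<union>
      {g x (c \<odot>\<^bsub>N\<^esub> y) \<ominus>\<^bsub>F\<^esub> (c \<odot>\<^bsub>F\<^esub> g x y) | c x y.
          c \<in> carrier R \<and> x \<in> carrier M \<and> y \<in> carrier N})"

definition tensor_kernel ::
  "('k, 'r) ring_scheme \<Rightarrow> ('k, 'a, 'm) module_scheme \<Rightarrow> ('k, 'b, 'n) module_scheme \<Rightarrow> ('a \<times> 'b \<Rightarrow> 'k) set"
  where "tensor_kernel R M N =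
    \<Inter> {S. submodule S R (free_module R (carrier M \<times> carrier N)) \<and> tensor_relators R M N \<subseteq> S}"

definition tensor_module ::
  "('k, 'r) ring_scheme \<Rightarrow> ('k, 'a, 'm) module_scheme \<Rightarrow> ('k, 'b, 'n) module_scheme \<Rightarrow>
    ('k, ('a \<times> 'b \<Rightarrow> 'k) set) module"
  where "tensor_module R M N =
    (let F = free_module R (carrier M \<times> carrier N); K = tensor_kernel R M N in
      \<lparr> carrier = a_rcosets\<^bsub>F\<^esub> K,
        mult = undefined,
        one = undefined,
        zero = K,
        add = (\<lambda>S T. S <+>\<^bsub>F\<^esub> T),
        smult = (\<lambda>c T. \<Union>u\<in>T. K +>\<^bsub>F\<^esub> (c \<odot>\<^bsub>F\<^esub> u)) \<rparr>)"

definition pure_tensor ::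
  "('k, 'r) ring_scheme \<Rightarrow> ('k, 'a, 'm) module_scheme \<Rightarrow> ('k, 'b, 'n) module_scheme \<Rightarrow>
    'a \<Rightarrow> 'b \<Rightarrow> ('a \<times> 'b \<Rightarrow> 'k) set"
  where "pure_tensor R M N x y =
    tensor_kernel R M N +>\<^bsub>free_module R (carrier M \<times> carrier N)\<^esub> free_gen R (x, y)"

text \<open>The linear map out of the tensor product (the factors are not needed as arguments)
  induced by a bilinear map \<open>f\<close> to \<open>P\<close>: it sends the class of \<open>u\<close> to
  \<open>\<Sum>(x, y). u (x, y) f x y\<close>.  For bilinear \<open>f\<close> the value does not depend on the chosen
  representative.\<close>

definition tensor_lift ::
  "('k, 'r) ring_scheme \<Rightarrow> ('k, 'c, 'p) module_scheme \<Rightarrow> ('a \<Rightarrow> 'b \<Rightarrow> 'c) \<Rightarrow> ('a \<times> 'b \<Rightarrow> 'k) set \<Rightarrow> 'c"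
  where "tensor_lift R P f T =
    (let u = (SOME u. u \<in> T) in
      finsum P (\<lambda>(x, y). u (x, y) \<odot>\<^bsub>P\<^esub> f x y) {p. u p \<noteq> \<zero>\<^bsub>R\<^esub>})"

text \<open>The same module, with the multiplication determined by
  \<open>(x \<otimes> y) (x' \<otimes> y') = x x' \<otimes> y y'\<close> (meaningful when both factors are algebras).\<close>

definition tensor ::
  "('k, 'r) ring_scheme \<Rightarrow> ('k, 'a, 'm) module_scheme \<Rightarrow> ('k, 'b, 'n) module_scheme \<Rightarrow>
    ('k, ('a \<times> 'b \<Rightarrow> 'k) set) module"
  where "tensor R A B =
    (let T = tensor_module R A B in
      T\<lparr> mult := (\<lambda>s t.
            tensor_lift R T (\<lambda>x y.
              tensor_lift R T (\<lambda>x' y'. pure_tensor R A B (x \<otimes>\<^bsub>A\<^esub> x') (y \<otimes>\<^bsub>B\<^esub> y')) t) s),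
         one := pure_tensor R A B \<one>\<^bsub>A\<^esub> \<one>\<^bsub>B\<^esub> \<rparr>)"

text \<open>The map \<open>f \<otimes> g\<close> into \<open>M' \<otimes> N'\<close>; only the target modules are arguments.\<close>

definition tensor_map ::
  "('k, 'r) ring_scheme \<Rightarrow> ('k, 'c, 'm) module_scheme \<Rightarrow> ('k, 'd, 'n) module_scheme \<Rightarrow>
    ('a \<Rightarrow> 'c) \<Rightarrow> ('b \<Rightarrow> 'd) \<Rightarrow> ('a \<times> 'b \<Rightarrow> 'k) set \<Rightarrow> ('c \<times> 'd \<Rightarrow> 'k) set"
  where "tensor_map R M' N' f g =
    tensor_lift R (tensor R M' N') (\<lambda>x y. pure_tensor R M' N' (f x) (g y))"

text \<open>The canonical isomorphism from \<open>(L \<otimes> M) \<otimes> N\<close> to \<open>L \<otimes> (M \<otimes> N)\<close>, by which the two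
  bracketings of a triple tensor product are identified.\<close>

definition tensor_assoc ::
  "('k, 'r) ring_scheme \<Rightarrow> ('k, 'a, 'l) module_scheme \<Rightarrow> ('k, 'b, 'm) module_scheme \<Rightarrow>
    ('k, 'c, 'n) module_scheme \<Rightarrow>
    (('a \<times> 'b \<Rightarrow> 'k) set \<times> 'c \<Rightarrow> 'k) set \<Rightarrow> ('a \<times> ('b \<times> 'c \<Rightarrow> 'k) set \<Rightarrow> 'k) set"
  where "tensor_assoc R L M N =
    (let P = tensor R L (tensor R M N) in
      tensor_lift R P (\<lambda>s z.
        tensor_lift R P (\<lambda>x y.
          pure_tensor R L (tensor R M N) x (pure_tensor R M N y z)) s))"


section \<open>Hopf algebras\<close>

definition coassociative ::
  "('k, 'r) ring_scheme \<Rightarrow> ('k, 'a, 'm) module_scheme \<Rightarrow> ('a \<Rightarrow> ('a \<times> 'a \<Rightarrow> 'k) set) \<Rightarrow> bool"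
  where "coassociative R H d \<longleftrightarrow>
    (\<forall>a\<in>carrier H.
      tensor_assoc R H H H (tensor_map R (tensor R H H) H d (\<lambda>x. x) (d a)) =
      tensor_map R H (tensor R H H) (\<lambda>x. x) d (d a))"

text \<open>In the counit axioms, \<open>R \<otimes> H\<close> and \<open>H \<otimes> R\<close> are identified with \<open>H\<close>.\<close>

locale hopf_algebra = field R + assoc_algebra R H
  for R (structure) and H (structure) +
  fixes \<Delta> :: "'c \<Rightarrow> ('c \<times> 'c \<Rightarrow> 'a) set"
    and \<epsilon> :: "'c \<Rightarrow> 'a"
    and S :: "'c \<Rightarrow> 'c"
  assumes comult_linear: "\<Delta> \<in> linear_maps R H (tensor R H H)"
    and comult_ring_hom: "\<Delta> \<in> ring_hom H (tensor R H H)"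
    and comult_coassoc: "coassociative R H \<Delta>"
    and counit_ring_hom: "\<epsilon> \<in> ring_hom H R"
    and counit_smult:
      "\<lbrakk>c \<in> carrier R; a \<in> carrier H\<rbrakk> \<Longrightarrow> \<epsilon> (c \<odot>\<^bsub>H\<^esub> a) = c \<otimes>\<^bsub>R\<^esub> \<epsilon> a"
    and counit_left:
      "a \<in> carrier H \<Longrightarrow> tensor_lift R H (\<lambda>x y. \<epsilon> x \<odot>\<^bsub>H\<^esub> y) (\<Delta> a) = a"
    and counit_right:
      "a \<in> carrier H \<Longrightarrow> tensor_lift R H (\<lambda>x y. \<epsilon> y \<odot>\<^bsub>H\<^esub> x) (\<Delta> a) = a"
    and antipode_linear: "S \<in> linear_maps R H H"
    and antipode_left:
      "a \<in> carrier H \<Longrightarrow> tensor_lift R H (\<lambda>x y. S x \<otimes>\<^bsub>H\<^esub> y) (\<Delta> a) = \<epsilon> a \<odot>\<^bsub>H\<^esub> \<one>\<^bsub>H\<^esub>"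
    and antipode_right:
      "a \<in> carrier H \<Longrightarrow> tensor_lift R H (\<lambda>x y. x \<otimes>\<^bsub>H\<^esub> S y) (\<Delta> a) = \<epsilon> a \<odot>\<^bsub>H\<^esub> \<one>\<^bsub>H\<^esub>"

text \<open>\<open>\<epsilon> \<otimes> id\<close> and \<open>id \<otimes> \<epsilon>\<close> as maps from \<open>H \<otimes> H\<close> to itself: the field is identified
  with its image in the factor of \<open>H \<otimes> H\<close> to which \<open>\<epsilon>\<close> is applied.\<close>

definition counit_id ::
  "('k, 'r) ring_scheme \<Rightarrow> ('k, 'a, 'm) module_scheme \<Rightarrow> ('a \<Rightarrow> 'k) \<Rightarrow>
    ('a \<times> 'a \<Rightarrow> 'k) set \<Rightarrow> ('a \<times> 'a \<Rightarrow> 'k) set"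
  where "counit_id R H \<epsilon> = tensor_map R H H (\<lambda>x. \<epsilon> x \<odot>\<^bsub>H\<^esub> \<one>\<^bsub>H\<^esub>) (\<lambda>x. x)"

definition id_counit ::
  "('k, 'r) ring_scheme \<Rightarrow> ('k, 'a, 'm) module_scheme \<Rightarrow> ('a \<Rightarrow> 'k) \<Rightarrow>
    ('a \<times> 'a \<Rightarrow> 'k) set \<Rightarrow> ('a \<times> 'a \<Rightarrow> 'k) set"
  where "id_counit R H \<epsilon> = tensor_map R H H (\<lambda>x. x) (\<lambda>x. \<epsilon> x \<odot>\<^bsub>H\<^esub> \<one>\<^bsub>H\<^esub>)"

definition is_twist ::
  "('k, 'r) ring_scheme \<Rightarrow> ('k, 'a, 'm) module_scheme \<Rightarrow> ('a \<Rightarrow> ('a \<times> 'a \<Rightarrow> 'k) set) \<Rightarrow>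
    ('a \<Rightarrow> 'k) \<Rightarrow> ('a \<times> 'a \<Rightarrow> 'k) set \<Rightarrow> bool"
  where "is_twist R H \<Delta> \<epsilon> F \<longleftrightarrow>
    (let HH = tensor R H H in
      F \<in> carrier HH \<and>
      tensor_assoc R H H H
        (pure_tensor R HH H F \<one>\<^bsub>H\<^esub> \<otimes>\<^bsub>tensor R HH H\<^esub> tensor_map R HH H \<Delta> (\<lambda>x. x) F) =
      pure_tensor R H HH \<one>\<^bsub>H\<^esub> F \<otimes>\<^bsub>tensor R H HH\<^esub> tensor_map R H HH (\<lambda>x. x) \<Delta> F \<and>
      counit_id R H \<epsilon> F = pure_tensor R H H \<one>\<^bsub>H\<^esub> \<one>\<^bsub>H\<^esub> \<and>
      id_counit R H \<epsilon> F = pure_tensor R H H \<one>\<^bsub>H\<^esub> \<one>\<^bsub>H\<^esub>)"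

definition twisted_coproduct_conditions ::
  "('k, 'r) ring_scheme \<Rightarrow> ('k, 'a, 'm) module_scheme \<Rightarrow> ('a \<Rightarrow> ('a \<times> 'a \<Rightarrow> 'k) set) \<Rightarrow>
    ('a \<Rightarrow> 'k) \<Rightarrow> ('a \<Rightarrow> ('a \<times> 'a \<Rightarrow> 'k) set) \<Rightarrow> bool"
  where "twisted_coproduct_conditions R H \<Delta> \<epsilon> d \<longleftrightarrow>
    coassociative R H d \<and>
    (\<forall>a\<in>carrier H. \<forall>b\<in>carrier H. d (a \<otimes>\<^bsub>H\<^esub> b) = d a \<otimes>\<^bsub>tensor R H H\<^esub> \<Delta> b) \<and>
    (\<forall>a\<in>carrier H. counit_id R H \<epsilon> (d a) = pure_tensor R H H \<one>\<^bsub>H\<^esub> a \<and>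
                   id_counit R H \<epsilon> (d a) = pure_tensor R H H a \<one>\<^bsub>H\<^esub>)"

end

(* The map d is determined by d(1) = F: condition (b) gives d(a) = d(1 a) = F \<Delta>(a).  On pure
   tensors, hence everywhere, d \<otimes> id = F_12 (\<Delta> \<otimes> id) and id \<otimes> d = F_23 (id \<otimes> \<Delta>).  So the cocycle
   condition is coassociativity of d at 1; conversely, multiplying it by (\<Delta> \<otimes> id) \<Delta>(a) =
   (id \<otimes> \<Delta>) \<Delta>(a) gives coassociativity of d at a, as \<Delta> \<otimes> id and id \<otimes> \<Delta> are multiplicative.
   Since \<epsilon> \<otimes> id and id \<otimes> \<epsilon> are multiplicative too, (c) reduces to the normalization of F. *)
theory Submission
  imports Defs
begin

section \<open>Linear maps\<close>

text \<open>The two sides of the cocycle condition live in different algebras,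
  \<open>(H \<otimes> H) \<otimes> H\<close> and \<open>H \<otimes> (H \<otimes> H)\<close>.
  Multiplying it by the coassociativity of \<Delta> therefore takes two facts: both triple products
  are associative algebras, and the associator between them is multiplicative. The obstacle is the
  concrete tensor product. Its elements are cosets, and a map out of it evaluates a representative
  picked by \<open>SOME\<close>, so nothing can be computed before the universal property is
  available: a lift of a bilinear map vanishes on the kernel, hence ignores the choice, and has the
  expected values on pure tensors. The product of tensors and the associator are lifts nested inside
  lifts. Their linearity in each argument comes from \<open>tensor_lift_bilinear\<close>, which
  treats all but one tensor argument as a parameter. With additivity in each slot secured, the
  algebra laws and the multiplicativity of maps reduce to pure tensors by induction on one argument
  at a time.\<close>

lemma linear_mapsI:
  assumes "\<And>x. x \<in> carrier M \<Longrightarrow> f x \<in> carrier N"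
    and "\<And>x y. x \<in> carrier M \<Longrightarrow> y \<in> carrier M \<Longrightarrow> f (x \<oplus>\<^bsub>M\<^esub> y) = f x \<oplus>\<^bsub>N\<^esub> f y"
    and "\<And>c x. c \<in> carrier R \<Longrightarrow> x \<in> carrier M \<Longrightarrow> f (c \<odot>\<^bsub>M\<^esub> x) = c \<odot>\<^bsub>N\<^esub> f x"
  shows "f \<in> linear_maps R M N"
  using assms by (auto simp: linear_maps_def)

lemma linear_mapsD:
  assumes "f \<in> linear_maps R M N"
  shows "x \<in> carrier M \<Longrightarrow> f x \<in> carrier N"
    and "x \<in> carrier M \<Longrightarrow> y \<in> carrier M \<Longrightarrow> f (x \<oplus>\<^bsub>M\<^esub> y) = f x \<oplus>\<^bsub>N\<^esub> f y"
    and "c \<in> carrier R \<Longrightarrow> x \<in> carrier M \<Longrightarrow> f (c \<odot>\<^bsub>M\<^esub> x) = c \<odot>\<^bsub>N\<^esub> f x"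
  using assms by (auto simp: linear_maps_def)

lemma linear_maps_comp:
  assumes "f \<in> linear_maps R M N" "g \<in> linear_maps R N P"
  shows "(\<lambda>x. g (f x)) \<in> linear_maps R M P"
  using assms by (auto simp: linear_maps_def Pi_iff)

lemma linear_maps_id: "(\<lambda>x. x) \<in> linear_maps R M M"
  by (auto simp: linear_maps_def)

lemma linear_maps_zero:
  assumes "f \<in> linear_maps R M N" "module R M" "module R N"
  shows "f \<zero>\<^bsub>M\<^esub> = \<zero>\<^bsub>N\<^esub>"
proof -
  interpret M: module R M by fact
  interpret N: module R N by fact
  \<comment> \<open>Zero is written as zero times zero, so homogeneity alone gives the
    claim.\<close>
  have "f (\<zero>\<^bsub>R\<^esub> \<odot>\<^bsub>M\<^esub> \<zero>\<^bsub>M\<^esub>) = \<zero>\<^bsub>R\<^esub> \<odot>\<^bsub>N\<^esub> f \<zero>\<^bsub>M\<^esub>"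
    by (rule linear_mapsD[OF assms(1)]) auto
  then show ?thesis
    using linear_mapsD(1)[OF assms(1)] by simp
qed

lemma linear_maps_minus:
  assumes "f \<in> linear_maps R M N" "module R M" "module R N"
    and "x \<in> carrier M" "y \<in> carrier M"
  shows "f (x \<ominus>\<^bsub>M\<^esub> y) = f x \<ominus>\<^bsub>N\<^esub> f y"
proof -
  interpret M: module R M by fact
  interpret N: module R N by fact
  note f = linear_mapsD[OF assms(1)]
  have *: "\<ominus>\<^bsub>M\<^esub> y = (\<ominus>\<^bsub>R\<^esub> \<one>\<^bsub>R\<^esub>) \<odot>\<^bsub>M\<^esub> y" "\<ominus>\<^bsub>N\<^esub> f y = (\<ominus>\<^bsub>R\<^esub> \<one>\<^bsub>R\<^esub>) \<odot>\<^bsub>N\<^esub> f y"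
    using assms f by (simp_all add: M.smult_l_minus N.smult_l_minus)
  show ?thesis
    using assms f by (simp add: a_minus_def *)
qed

lemma linear_maps_kernel:
  assumes "f \<in> linear_maps R M N" "module R M" "module R N"
  shows "submodule {x \<in> carrier M. f x = \<zero>\<^bsub>N\<^esub>} R M"
proof -
  interpret M: module R M by fact
  interpret N: module R N by fact
  note f = linear_mapsD[OF assms(1)]
  have "f (\<ominus>\<^bsub>M\<^esub> a) = \<zero>\<^bsub>N\<^esub>" if "a \<in> carrier M" "f a = \<zero>\<^bsub>N\<^esub>" for a
    using linear_maps_minus[OF assms M.zero_closed that(1)] that
      linear_maps_zero[OF assms] by (simp add: M.minus_eq N.minus_eq)
  then show ?thesis
    by (intro M.submoduleI) (auto simp: f linear_maps_zero[OF assms])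
qed

lemma linear_maps_add:
  assumes "f \<in> linear_maps R M N" "g \<in> linear_maps R M N" "module R N"
  shows "(\<lambda>x. f x \<oplus>\<^bsub>N\<^esub> g x) \<in> linear_maps R M N"
proof -
  interpret N: module R N by fact
  show ?thesis
    by (rule linear_mapsI)
      (simp_all add: linear_mapsD[OF assms(1)] linear_mapsD[OF assms(2)] N.smult_r_distr
        N.a_ac N.add.m_closed)
qed

lemma linear_maps_cong:
  assumes "f \<in> linear_maps R M N" "module R M" "\<And>x. x \<in> carrier M \<Longrightarrow> g x = f x"
  shows "g \<in> linear_maps R M N"
proof -
  interpret M: module R M by fact
  show ?thesis
    by (rule linear_mapsI) (simp_all add: assms(3) linear_mapsD[OF assms(1)])
qed


section \<open>Free modules\<close>

lemma (in cring) free_module_module: "module R (free_module R X)"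
proof (rule moduleI)
  let ?F = "free_module R X"
  \<comment> \<open>Pointwise operations that send zeros to zero have their support inside the union
    of the supports of the operands.\<close>
  have fin: "finite {p. c p \<noteq> \<zero>}"
    if "finite {p. a p \<noteq> \<zero>}" "finite {p. b p \<noteq> \<zero>}" "\<And>p. a p = \<zero> \<Longrightarrow> b p = \<zero> \<Longrightarrow> c p = \<zero>"
    for a b c :: "_ \<Rightarrow> 'a"
    by (rule finite_subset[OF _ finite_UnI[OF that(1,2)]]) (use that(3) in auto)
  have fin1: "finite {p. c p \<noteq> \<zero>}"
    if "finite {p. a p \<noteq> \<zero>}" "\<And>p. a p = \<zero> \<Longrightarrow> c p = \<zero>"
    for a c :: "_ \<Rightarrow> 'a"
    by (rule fin[OF that(1) that(1)]) (rule that(2))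
  \<comment> \<open>Outside \<open>X\<close> the value is zero, which also lies in
    \<open>carrier R\<close>; so the ring laws apply at every point without a case split.\<close>
  have cl: "u p \<in> carrier R" if "u \<in> carrier ?F" for u p
    using that by (cases "p \<in> X") (auto simp: free_module_def)
  show "cring R" by (rule is_cring)
  show "abelian_group ?F"
  proof (rule abelian_groupI)
    fix u v w assume u: "u \<in> carrier ?F" and v: "v \<in> carrier ?F" and w: "w \<in> carrier ?F"
    show "u \<oplus>\<^bsub>?F\<^esub> v \<in> carrier ?F"
      using u v by (auto simp: free_module_def intro: fin[of u v])
    show "u \<oplus>\<^bsub>?F\<^esub> v \<oplus>\<^bsub>?F\<^esub> w = u \<oplus>\<^bsub>?F\<^esub> (v \<oplus>\<^bsub>?F\<^esub> w)"
      using u v w by (auto simp: free_module_def a_assoc cl[OF u] cl[OF v] cl[OF w])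
    show "u \<oplus>\<^bsub>?F\<^esub> v = v \<oplus>\<^bsub>?F\<^esub> u"
      using u v by (auto simp: free_module_def a_comm cl[OF u] cl[OF v])
    show "\<zero>\<^bsub>?F\<^esub> \<oplus>\<^bsub>?F\<^esub> u = u"
      using u by (auto simp: free_module_def cl[OF u])
    show "\<exists>y\<in>carrier ?F. y \<oplus>\<^bsub>?F\<^esub> u = \<zero>\<^bsub>?F\<^esub>"
    proof (rule bexI)
      show "(\<lambda>p. \<ominus> u p) \<oplus>\<^bsub>?F\<^esub> u = \<zero>\<^bsub>?F\<^esub>"
        using u by (auto simp: free_module_def l_neg cl[OF u])
      show "(\<lambda>p. \<ominus> u p) \<in> carrier ?F"
        using u by (auto simp: free_module_def elim!: fin1)
    qed
  qed (auto simp: free_module_def)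
  show "\<one> \<odot>\<^bsub>?F\<^esub> u = u" if "u \<in> carrier ?F" for u
    using cl[OF that] by (auto simp: free_module_def)
  fix a b u v assume a: "a \<in> carrier R" and b: "b \<in> carrier R"
    and u: "u \<in> carrier ?F" and v: "v \<in> carrier ?F"
  show "a \<odot>\<^bsub>?F\<^esub> u \<in> carrier ?F"
    using u a by (auto simp: free_module_def elim!: fin1)
  show "(a \<oplus> b) \<odot>\<^bsub>?F\<^esub> u = a \<odot>\<^bsub>?F\<^esub> u \<oplus>\<^bsub>?F\<^esub> b \<odot>\<^bsub>?F\<^esub> u"
    using a b by (auto simp: free_module_def l_distr cl[OF u])
  show "a \<odot>\<^bsub>?F\<^esub> (u \<oplus>\<^bsub>?F\<^esub> v) = a \<odot>\<^bsub>?F\<^esub> u \<oplus>\<^bsub>?F\<^esub> a \<odot>\<^bsub>?F\<^esub> v"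
    using a by (auto simp: free_module_def r_distr cl[OF u] cl[OF v])
  show "(a \<otimes> b) \<odot>\<^bsub>?F\<^esub> u = a \<odot>\<^bsub>?F\<^esub> (b \<odot>\<^bsub>?F\<^esub> u)"
    using a b by (auto simp: free_module_def m_assoc cl[OF u])
qed

lemma (in cring) free_gen_closed:
  "p \<in> X \<Longrightarrow> free_gen R p \<in> carrier (free_module R X)"
  by (auto simp: free_gen_def free_module_def)

text \<open>Induction on the finite support: setting one coordinate \<open>p\<close> of
  \<open>u\<close> to zero splits off \<open>u p\<close> times the generator of
  \<open>p\<close>.\<close>

lemma (in cring) free_module_induct [consumes 1, case_names zero add]:
  assumes "u \<in> carrier (free_module R X)"
    and zero: "P \<zero>\<^bsub>free_module R X\<^esub>"
    and add: "\<And>c p v. \<lbrakk>c \<in> carrier R; p \<in> X; v \<in> carrier (free_module R X); P v\<rbrakk> \<Longrightarrow>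
      P (c \<odot>\<^bsub>free_module R X\<^esub> free_gen R p \<oplus>\<^bsub>free_module R X\<^esub> v)"
  shows "P u"
proof -
  let ?F = "free_module R X"
  have "finite {p. u p \<noteq> \<zero>}"
    using assms(1) by (auto simp: free_module_def)
  then show ?thesis using assms(1)
  proof (induction "{p. u p \<noteq> \<zero>}" arbitrary: u rule: finite_induct)
    case empty
    then have "u = \<zero>\<^bsub>?F\<^esub>"
      by (auto simp: free_module_def fun_eq_iff)
    with zero show ?case by simp
  next
    case (insert p A)
    have supp: "{q. u q \<noteq> \<zero>} = insert p A" using insert.hyps by simp
    define v where "v = u(p := \<zero>)"
    have p: "p \<in> X" "u p \<in> carrier R" and uc: "\<And>q. u q \<in> carrier R"
      using insert.prems supp by (auto simp: free_module_def)
    have "{q. v q \<noteq> \<zero>} = A"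
      using supp insert.hyps by (auto simp: v_def)
    moreover from this have v: "v \<in> carrier ?F"
      using insert.prems insert.hyps by (auto simp: free_module_def v_def)
    ultimately have "P v" using insert.hyps by blast
    moreover have "u = u p \<odot>\<^bsub>?F\<^esub> free_gen R p \<oplus>\<^bsub>?F\<^esub> v"
      using uc by (auto simp: free_module_def free_gen_def v_def fun_eq_iff)
    ultimately show ?case using add p v by metis
  qed
qed

text \<open>The linear extension of \<open>f\<close> from the generators. It is the sum occurring in
  \<open>tensor_lift\<close>, so that a tensor lift is a free lift evaluated at the chosen
  representative.\<close>

definition free_lift ::
  "('k, 'r) ring_scheme \<Rightarrow> ('k, 'c, 'p) module_scheme \<Rightarrow> ('x \<Rightarrow> 'c) \<Rightarrow> ('x \<Rightarrow> 'k) \<Rightarrow> 'c"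
  where "free_lift R P f u = finsum P (\<lambda>p. u p \<odot>\<^bsub>P\<^esub> f p) {p. u p \<noteq> \<zero>\<^bsub>R\<^esub>}"

context module
begin

text \<open>Indices off the support contribute zero. Additivity depends on this freedom:
  \<open>u\<close>, \<open>v\<close> and their sum have different supports and must be summed over
  one common index set.\<close>

lemma free_lift_superset:
  assumes "f \<in> X \<rightarrow> carrier M" "u \<in> carrier (free_module R X)"
    and "finite A" "{p. u p \<noteq> \<zero>} \<subseteq> A" "A \<subseteq> X"
  shows "free_lift R M f u = finsum M (\<lambda>p. u p \<odot>\<^bsub>M\<^esub> f p) A"
  unfolding free_lift_def
  by (rule M.add.finprod_mono_neutral_cong_left)
    (use assms in \<open>auto simp: free_module_def Pi_iff subset_iff\<close>)

lemma free_lift_linear: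
  assumes f: "f \<in> X \<rightarrow> carrier M"
  shows "free_lift R M f \<in> linear_maps R (free_module R X) M"
proof (rule linear_mapsI)
  let ?F = "free_module R X"
  interpret F: module R ?F by (rule R.free_module_module)
  have supp: "finite {p. u p \<noteq> \<zero>}" "{p. u p \<noteq> \<zero>} \<subseteq> X" if "u \<in> carrier ?F" for u
    using that by (auto simp: free_module_def)
  have cl: "u p \<in> carrier R" if "u \<in> carrier ?F" for u p
    using that by (cases "p \<in> X") (auto simp: free_module_def)
  have cl': "(\<lambda>p. u p \<odot>\<^bsub>M\<^esub> f p) \<in> A \<rightarrow> carrier M" if "u \<in> carrier ?F" "A \<subseteq> X" for u A
    using that(2) f cl[OF that(1)] by (auto simp: Pi_iff subset_iff)
  fix u assume u: "u \<in> carrier ?F"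
  show "free_lift R M f u \<in> carrier M"
    unfolding free_lift_def using cl'[OF u] supp[OF u] by (auto intro: M.finsum_closed)
  {
    fix v assume v: "v \<in> carrier ?F"
    let ?A = "{p. u p \<noteq> \<zero>} \<union> {p. v p \<noteq> \<zero>}"
    have A: "finite ?A" "?A \<subseteq> X" using supp u v by auto
    have uv: "{p. (u \<oplus>\<^bsub>?F\<^esub> v) p \<noteq> \<zero>} \<subseteq> ?A"
      by (auto simp: free_module_def)
    have "free_lift R M f (u \<oplus>\<^bsub>?F\<^esub> v) = finsum M (\<lambda>p. (u \<oplus>\<^bsub>?F\<^esub> v) p \<odot>\<^bsub>M\<^esub> f p) ?A"
      by (rule free_lift_superset[OF f F.a_closed[OF u v] A(1) uv A(2)])
    also have "\<dots> = finsum M (\<lambda>p. u p \<odot>\<^bsub>M\<^esub> f p \<oplus>\<^bsub>M\<^esub> v p \<odot>\<^bsub>M\<^esub> f p) ?A"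
    proof (rule M.finsum_cong')
      show "(\<lambda>p. u p \<odot>\<^bsub>M\<^esub> f p \<oplus>\<^bsub>M\<^esub> v p \<odot>\<^bsub>M\<^esub> f p) \<in> ?A \<rightarrow> carrier M"
        using cl' u v A by blast
      fix p assume "p \<in> ?A"
      then have "f p \<in> carrier M" using A f by blast
      then show "(u \<oplus>\<^bsub>?F\<^esub> v) p \<odot>\<^bsub>M\<^esub> f p = u p \<odot>\<^bsub>M\<^esub> f p \<oplus>\<^bsub>M\<^esub> v p \<odot>\<^bsub>M\<^esub> f p"
        using cl u v by (simp add: free_module_def smult_l_distr)
    qed simp
    also have "\<dots> = finsum M (\<lambda>p. u p \<odot>\<^bsub>M\<^esub> f p) ?A \<oplus>\<^bsub>M\<^esub> finsum M (\<lambda>p. v p \<odot>\<^bsub>M\<^esub> f p) ?A"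
      using cl' u v A by (intro M.finsum_addf) auto
    also have "\<dots> = free_lift R M f u \<oplus>\<^bsub>M\<^esub> free_lift R M f v"
      using A by (subst (1 2) free_lift_superset[OF f _ A(1) _ A(2)]) (auto simp: u v)
    finally show "free_lift R M f (u \<oplus>\<^bsub>?F\<^esub> v) = free_lift R M f u \<oplus>\<^bsub>M\<^esub> free_lift R M f v" .
  }
  fix c assume c: "c \<in> carrier R"
  let ?A = "{p. u p \<noteq> \<zero>}"
  have uv: "{p. (c \<odot>\<^bsub>?F\<^esub> u) p \<noteq> \<zero>} \<subseteq> ?A"
    using c by (auto simp: free_module_def)
  have "free_lift R M f (c \<odot>\<^bsub>?F\<^esub> u) = finsum M (\<lambda>p. (c \<odot>\<^bsub>?F\<^esub> u) p \<odot>\<^bsub>M\<^esub> f p) ?A"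
    by (rule free_lift_superset[OF f F.smult_closed[OF c u] supp(1)[OF u] uv supp(2)[OF u]])
  also have "\<dots> = finsum M (\<lambda>p. c \<odot>\<^bsub>M\<^esub> (u p \<odot>\<^bsub>M\<^esub> f p)) ?A"
  proof (rule M.finsum_cong')
    show "(\<lambda>p. c \<odot>\<^bsub>M\<^esub> (u p \<odot>\<^bsub>M\<^esub> f p)) \<in> ?A \<rightarrow> carrier M"
      using cl'[OF u supp(2)[OF u]] c by blast
    fix p assume "p \<in> ?A"
    then have "f p \<in> carrier M" using supp[OF u] f by blast
    then show "(c \<odot>\<^bsub>?F\<^esub> u) p \<odot>\<^bsub>M\<^esub> f p = c \<odot>\<^bsub>M\<^esub> (u p \<odot>\<^bsub>M\<^esub> f p)"
      using cl u c by (simp add: free_module_def smult_assoc1)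
  qed simp
  also have "\<dots> = c \<odot>\<^bsub>M\<^esub> free_lift R M f u"
    unfolding free_lift_def
    by (rule finsum_smult_ldistr[symmetric]) (use cl'[OF u supp(2)[OF u]] supp[OF u] c in auto)
  finally show "free_lift R M f (c \<odot>\<^bsub>?F\<^esub> u) = c \<odot>\<^bsub>M\<^esub> free_lift R M f u" .
qed

lemma free_lift_gen:
  assumes "f \<in> X \<rightarrow> carrier M" "p \<in> X"
  shows "free_lift R M f (free_gen R p) = f p"
proof -
  have "free_lift R M f (free_gen R p) = finsum M (\<lambda>q. free_gen R p q \<odot>\<^bsub>M\<^esub> f q) {p}"
    by (rule free_lift_superset[OF assms(1) R.free_gen_closed[OF assms(2)]])
      (use assms in \<open>auto simp: free_gen_def\<close>)
  then show ?thesis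
    using assms by (simp add: free_gen_def Pi_iff)
qed

end

section \<open>Tensor products of modules\<close>

text \<open>Phrased through \<open>linear_maps\<close> in each curried argument, so that composition
  and the rules for linear maps can be reused slot by slot.\<close>

definition bilinear_maps ::
  "('k, 'r) ring_scheme \<Rightarrow> ('k, 'a, 'm) module_scheme \<Rightarrow> ('k, 'b, 'n) module_scheme \<Rightarrow>
    ('k, 'c, 'p) module_scheme \<Rightarrow> ('a \<Rightarrow> 'b \<Rightarrow> 'c) set"
  where "bilinear_maps R M N P =
    {f. (\<forall>x\<in>carrier M. f x \<in> linear_maps R N P) \<and>
        (\<forall>y\<in>carrier N. (\<lambda>x. f x y) \<in> linear_maps R M P)}"

lemma bilinear_mapsI:
  assumes "\<And>x. x \<in> carrier M \<Longrightarrow> f x \<in> linear_maps R N P"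
    and "\<And>y. y \<in> carrier N \<Longrightarrow> (\<lambda>x. f x y) \<in> linear_maps R M P"
  shows "f \<in> bilinear_maps R M N P"
  using assms by (auto simp: bilinear_maps_def)

lemma bilinear_mapsD:
  assumes "f \<in> bilinear_maps R M N P"
  shows "x \<in> carrier M \<Longrightarrow> f x \<in> linear_maps R N P"
    and "y \<in> carrier N \<Longrightarrow> (\<lambda>x. f x y) \<in> linear_maps R M P"
  using assms by (auto simp: bilinear_maps_def)

lemma bilinear_maps_precompose:
  assumes f: "f \<in> bilinear_maps R M' N' P" and g: "g \<in> linear_maps R M M'" and h: "h \<in> linear_maps R N N'"
  shows "(\<lambda>x y. f (g x) (h y)) \<in> bilinear_maps R M N P"
proof (rule bilinear_mapsI)
  show "(\<lambda>y. f (g x) (h y)) \<in> linear_maps R N P" if "x \<in> carrier M" for x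
    by (rule linear_maps_comp[OF h bilinear_mapsD(1)[OF f]]) (rule linear_mapsD(1)[OF g that])
  show "(\<lambda>x. f (g x) (h y)) \<in> linear_maps R M P" if "y \<in> carrier N" for y
    by (rule linear_maps_comp[OF g bilinear_mapsD(2)[OF f]]) (rule linear_mapsD(1)[OF h that])
qed

lemma tensor_sel [simp]:
  "carrier (tensor R M N) = carrier (tensor_module R M N)"
  "zero (tensor R M N) = zero (tensor_module R M N)"
  "add (tensor R M N) = add (tensor_module R M N)"
  "smult (tensor R M N) = smult (tensor_module R M N)"
  by (simp_all add: tensor_def Let_def)

text \<open>The module axioms read only these four fields. This carries the module structure over
  from \<open>tensor_module\<close> to \<open>tensor\<close>, which differs from it just in product
  and unit.\<close>

lemma module_cong:
  fixes M N :: "('k, 'a, 'm) module_scheme"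
  assumes "module R M" "carrier N = carrier M" "zero N = zero M" "add N = add M" "smult N = smult M"
  shows "module R N"
proof -
  interpret M: module R M by fact
  have "add_monoid N = add_monoid M" using assms by simp
  then show ?thesis
    using M.a_comm_group M.a_comm_monoid M.is_cring assms
    by (intro moduleI)
      (auto simp: abelian_group_def abelian_monoid_def abelian_group_axioms_def
        M.smult_l_distr M.smult_r_distr M.smult_assoc1)
qed

lemma tensor_lift_eq_free_lift:
  "tensor_lift R P f T = free_lift R P (\<lambda>(x, y). f x y) (SOME u. u \<in> T)"
  by (simp add: tensor_lift_def free_lift_def Let_def case_prod_unfold)

text \<open>The product of \<open>tensor\<close> is defined by lifts into
  \<open>tensor_module\<close>, because the finished record is not yet there at that point. A lift
  reads only the additive and scalar fields of its target, so those lifts may be restated with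
  target \<open>tensor\<close>.\<close>

lemma tensor_lift_tensor:
  "tensor_lift R (tensor_module R M N) = tensor_lift R (tensor R M N)"
  by (simp add: fun_eq_iff tensor_lift_def Let_def finsum_def)

section \<open>The tensor product as a quotient of the free module\<close>

locale module_pair = M: module R M + N: module R N
  for R :: "('k, 'r) ring_scheme" (structure)
    and M :: "('k, 'a, 'm) module_scheme" (structure)
    and N :: "('k, 'b, 'n) module_scheme" (structure)
begin

abbreviation free_prod :: "('k, 'a \<times> 'b \<Rightarrow> 'k) module"
  where "free_prod \<equiv> free_module R (carrier M \<times> carrier N)"

abbreviation kernel :: "('a \<times> 'b \<Rightarrow> 'k) set"
  where "kernel \<equiv> tensor_kernel R M N"

sublocale F: module R free_prod
  by (rule M.free_module_module)

lemma gen_closed: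
  "x \<in> carrier M \<Longrightarrow> y \<in> carrier N \<Longrightarrow> free_gen R (x, y) \<in> carrier free_prod"
  by (rule M.free_gen_closed) simp

lemma relators_closed: "tensor_relators R M N \<subseteq> carrier free_prod"
  by (auto simp: tensor_relators_def Let_def intro!: F.minus_closed F.a_closed F.smult_closed gen_closed)

lemma kernel_submodule: "submodule kernel R free_prod"
proof (rule F.submoduleI)
  \<comment> \<open>The whole free module belongs to the intersected family; the intersection of an
    empty family would be the whole type.\<close>
  show "kernel \<subseteq> carrier free_prod"
    using F.carrier_is_submodule relators_closed unfolding tensor_kernel_def by blast
  have zero: "\<zero>\<^bsub>free_prod\<^esub> \<in> A" if "submodule A R free_prod" for A
  proof -
    interpret submodule A R free_prod by fact
    \<comment> \<open>A submodule is a subgroup of the additive monoid, whose neutral element is the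
      module's zero.\<close>
    show ?thesis using one_closed by simp
  qed
  then show "\<zero>\<^bsub>free_prod\<^esub> \<in> kernel"
    unfolding tensor_kernel_def by blast
  show "\<ominus>\<^bsub>free_prod\<^esub> a \<in> kernel" if "a \<in> kernel" for a
    using that F.submoduleE(3) unfolding tensor_kernel_def by blast
  show "a \<oplus>\<^bsub>free_prod\<^esub> b \<in> kernel" if "a \<in> kernel" "b \<in> kernel" for a b
    using that F.submoduleE(5) unfolding tensor_kernel_def by blast
  show "c \<odot>\<^bsub>free_prod\<^esub> a \<in> kernel" if "c \<in> carrier R" "a \<in> kernel" for c a
    using that F.submoduleE(4) unfolding tensor_kernel_def by blast
qed

lemma relators_in_kernel: "tensor_relators R M N \<subseteq> kernel"
  unfolding tensor_kernel_def by blast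

lemma kernel_least:
  "submodule A R free_prod \<Longrightarrow> tensor_relators R M N \<subseteq> A \<Longrightarrow> kernel \<subseteq> A"
  unfolding tensor_kernel_def by blast

sublocale K: abelian_subgroup kernel free_prod
  using kernel_submodule F.a_comm_group
  by (intro abelian_subgroupI2) (auto simp: submodule_def)

abbreviation coset :: "('a \<times> 'b \<Rightarrow> 'k) \<Rightarrow> ('a \<times> 'b \<Rightarrow> 'k) set"
  where "coset u \<equiv> kernel +>\<^bsub>free_prod\<^esub> u"

lemma coset_eq_iff:
  assumes "u \<in> carrier free_prod" "v \<in> carrier free_prod"
  shows "coset u = coset v \<longleftrightarrow> u \<ominus>\<^bsub>free_prod\<^esub> v \<in> kernel"
proof -
  have "coset u = coset v \<longleftrightarrow> u \<in> coset v"
    using K.a_repr_independence' K.a_repr_independenceD assms by metis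
  then show ?thesis
    using K.a_rcos_module[of v u] assms
    by (simp add: a_minus_def)
qed

lemma carrier_tensor_module: "carrier (tensor_module R M N) = coset ` carrier free_prod"
  by (auto simp: tensor_module_def Let_def A_RCOSETS_def' a_r_coset_def' image_iff)

lemma coset_add:
  "u \<in> carrier free_prod \<Longrightarrow> v \<in> carrier free_prod \<Longrightarrow>
    coset u \<oplus>\<^bsub>tensor_module R M N\<^esub> coset v = coset (u \<oplus>\<^bsub>free_prod\<^esub> v)"
  by (simp add: tensor_module_def Let_def K.a_rcos_sum)

lemma zero_tensor_module: "\<zero>\<^bsub>tensor_module R M N\<^esub> = coset \<zero>\<^bsub>free_prod\<^esub>"
  using K.a_rcos_const[OF K.zero_closed] by (simp add: tensor_module_def Let_def)

text \<open>The scalar action is a union over all representatives of the coset. Two representatives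
  differ by a kernel element and the kernel is stable under scalars, so all sets in the union are
  the same coset.\<close>

lemma coset_smult:
  assumes "c \<in> carrier R" "u \<in> carrier free_prod"
  shows "c \<odot>\<^bsub>tensor_module R M N\<^esub> coset u = coset (c \<odot>\<^bsub>free_prod\<^esub> u)"
proof -
  have "coset (c \<odot>\<^bsub>free_prod\<^esub> v) = coset (c \<odot>\<^bsub>free_prod\<^esub> u)" if "v \<in> coset u" for v
  proof -
    have v: "v \<in> carrier free_prod"
      using K.a_elemrcos_carrier[OF assms(2) that] .
    have "v \<ominus>\<^bsub>free_prod\<^esub> u \<in> kernel"
      using K.a_repr_independence'[OF that assms(2)] coset_eq_iff[OF v assms(2)] by simp
    then have "c \<odot>\<^bsub>free_prod\<^esub> (v \<ominus>\<^bsub>free_prod\<^esub> u) \<in> kernel"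
      using F.submoduleE(4)[OF kernel_submodule assms(1)] by simp
    moreover have "c \<odot>\<^bsub>free_prod\<^esub> (v \<ominus>\<^bsub>free_prod\<^esub> u) = c \<odot>\<^bsub>free_prod\<^esub> v \<ominus>\<^bsub>free_prod\<^esub> c \<odot>\<^bsub>free_prod\<^esub> u"
      using assms v by (simp add: a_minus_def F.smult_r_distr F.smult_r_minus)
    ultimately show ?thesis
      using coset_eq_iff[OF F.smult_closed[OF assms(1) v] F.smult_closed[OF assms]] by simp
  qed
  moreover have "u \<in> coset u" by (rule K.a_rcos_self[OF assms(2)])
  ultimately have "(\<Union>v\<in>coset u. coset (c \<odot>\<^bsub>free_prod\<^esub> v)) = coset (c \<odot>\<^bsub>free_prod\<^esub> u)"
    by blast
  then show ?thesis
    by (simp add: tensor_module_def Let_def)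
qed

lemma module_tensor_module: "module R (tensor_module R M N)"
proof (rule moduleI)
  let ?T = "tensor_module R M N"
  show "cring R" by (rule M.is_cring)
  show "abelian_group ?T"
  proof (rule abelian_groupI)
    fix x assume "x \<in> carrier ?T"
    then obtain u where u: "u \<in> carrier free_prod" "x = coset u"
      by (auto simp: carrier_tensor_module)
    have "coset (\<ominus>\<^bsub>free_prod\<^esub> u) \<oplus>\<^bsub>?T\<^esub> x = \<zero>\<^bsub>?T\<^esub>"
      using u by (simp add: coset_add zero_tensor_module F.l_neg)
    then show "\<exists>y\<in>carrier ?T. y \<oplus>\<^bsub>?T\<^esub> x = \<zero>\<^bsub>?T\<^esub>"
      using u by (auto simp: carrier_tensor_module)
  next
    fix x y assume "x \<in> carrier ?T" "y \<in> carrier ?T"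
    then show "x \<oplus>\<^bsub>?T\<^esub> y = y \<oplus>\<^bsub>?T\<^esub> x"
      by (auto simp: carrier_tensor_module coset_add F.a_comm)
  qed (auto simp: carrier_tensor_module coset_add zero_tensor_module F.a_assoc)
qed (auto simp: carrier_tensor_module coset_add coset_smult F.smult_l_distr F.smult_r_distr F.smult_assoc1)

lemma module_tensor: "module R (tensor R M N)"
  by (rule module_cong[OF module_tensor_module]) simp_all

sublocale T: module R "tensor R M N"
  by (rule module_tensor)

abbreviation pure :: "'a \<Rightarrow> 'b \<Rightarrow> ('a \<times> 'b \<Rightarrow> 'k) set"
  where "pure \<equiv> pure_tensor R M N"

text \<open>By \<open>coset_eq_iff\<close>, each linearity law amounts to one family of relators
  lying in the kernel.\<close>

lemma pure_tensor_bilinear: "pure \<in> bilinear_maps R M N (tensor R M N)"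
proof -
  let ?g = "\<lambda>x y. free_gen R (x, y)"
  note rel = subsetD[OF relators_in_kernel, unfolded tensor_relators_def Let_def]
  have "coset (?g (x \<oplus>\<^bsub>M\<^esub> x') y) = coset (?g x y \<oplus>\<^bsub>free_prod\<^esub> ?g x' y)"
    if "x \<in> carrier M" "x' \<in> carrier M" "y \<in> carrier N" for x x' y
    by (subst coset_eq_iff) (use that in \<open>auto intro!: gen_closed rel\<close>)
  moreover have "coset (?g x (y \<oplus>\<^bsub>N\<^esub> y')) = coset (?g x y \<oplus>\<^bsub>free_prod\<^esub> ?g x y')"
    if "x \<in> carrier M" "y \<in> carrier N" "y' \<in> carrier N" for x y y'
    by (subst coset_eq_iff) (use that in \<open>auto intro!: gen_closed rel\<close>)
  moreover have "coset (?g (c \<odot>\<^bsub>M\<^esub> x) y) = coset (c \<odot>\<^bsub>free_prod\<^esub> ?g x y)"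
    if "c \<in> carrier R" "x \<in> carrier M" "y \<in> carrier N" for c x y
    by (subst coset_eq_iff) (use that in \<open>auto intro!: gen_closed rel\<close>)
  moreover have "coset (?g x (c \<odot>\<^bsub>N\<^esub> y)) = coset (c \<odot>\<^bsub>free_prod\<^esub> ?g x y)"
    if "c \<in> carrier R" "x \<in> carrier M" "y \<in> carrier N" for c x y
    by (subst coset_eq_iff) (use that in \<open>auto intro!: gen_closed rel\<close>)
  ultimately show ?thesis
    by (intro bilinear_mapsI linear_mapsI)
      (simp_all add: pure_tensor_def carrier_tensor_module coset_add coset_smult gen_closed)
qed

lemmas pure_linear_right = bilinear_mapsD(1)[OF pure_tensor_bilinear]
  and pure_linear_left = bilinear_mapsD(2)[OF pure_tensor_bilinear]

lemma pure_closed [simp]: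
  "x \<in> carrier M \<Longrightarrow> y \<in> carrier N \<Longrightarrow> pure x y \<in> carrier (tensor R M N)"
  by (rule linear_mapsD(1)[OF pure_linear_right])

text \<open>There is no case for zero or for scalar multiples: a scalar is absorbed into the first
  factor of a pure tensor, and zero is itself a pure tensor.\<close>

lemma tensor_induct [consumes 1, case_names pure add]:
  assumes "t \<in> carrier (tensor R M N)"
    and pure: "\<And>x y. x \<in> carrier M \<Longrightarrow> y \<in> carrier N \<Longrightarrow> P (pure x y)"
    and add: "\<And>s t. \<lbrakk>s \<in> carrier (tensor R M N); t \<in> carrier (tensor R M N); P s; P t\<rbrakk> \<Longrightarrow>
      P (s \<oplus>\<^bsub>tensor R M N\<^esub> t)"
  shows "P t"
proof -
  obtain u where u: "u \<in> carrier free_prod" and t: "t = coset u"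
    using assms(1) by (auto simp: carrier_tensor_module)
  from u have "P (coset u)"
  proof (induction u rule: M.free_module_induct)
    case zero
    have "P (pure (\<zero>\<^bsub>R\<^esub> \<odot>\<^bsub>M\<^esub> \<zero>\<^bsub>M\<^esub>) \<zero>\<^bsub>N\<^esub>)"
      by (rule pure) auto
    also have "pure (\<zero>\<^bsub>R\<^esub> \<odot>\<^bsub>M\<^esub> \<zero>\<^bsub>M\<^esub>) \<zero>\<^bsub>N\<^esub> = \<zero>\<^bsub>R\<^esub> \<odot>\<^bsub>tensor R M N\<^esub> pure \<zero>\<^bsub>M\<^esub> \<zero>\<^bsub>N\<^esub>"
      by (rule linear_mapsD(3)[OF pure_linear_left]) auto
    also have "\<dots> = \<zero>\<^bsub>tensor R M N\<^esub>"
      by (rule T.smult_l_null) (rule pure_closed, auto)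
    finally show ?case by (simp add: zero_tensor_module)
  next
    case (add c p v)
    obtain x y where p: "p = (x, y)" "x \<in> carrier M" "y \<in> carrier N"
      using add by auto
    have "coset (c \<odot>\<^bsub>free_prod\<^esub> free_gen R p) = c \<odot>\<^bsub>tensor R M N\<^esub> pure x y"
      using add p by (simp add: pure_tensor_def coset_smult gen_closed)
    also have "\<dots> = pure (c \<odot>\<^bsub>M\<^esub> x) y"
      using linear_mapsD(3)[OF pure_linear_left] add p by metis
    finally have "P (coset (c \<odot>\<^bsub>free_prod\<^esub> free_gen R p))"
      using pure p add by simp
    then have "P (coset (c \<odot>\<^bsub>free_prod\<^esub> free_gen R p) \<oplus>\<^bsub>tensor R M N\<^esub> coset v)"
      using add p by (intro assms(3)) (auto simp: carrier_tensor_module gen_closed)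
    then show ?case
      using add p by (simp add: coset_add gen_closed)
  qed
  then show ?thesis using t by simp
qed

lemma linear_maps_eqI:
  assumes "f \<in> linear_maps R (tensor R M N) P" "g \<in> linear_maps R (tensor R M N) P"
    and "\<And>x y. x \<in> carrier M \<Longrightarrow> y \<in> carrier N \<Longrightarrow> f (pure x y) = g (pure x y)"
    and "t \<in> carrier (tensor R M N)"
  shows "f t = g t"
  using assms(4)
  by (induction t rule: tensor_induct) (simp_all only: assms(3) linear_mapsD(2)[OF assms(1)] linear_mapsD(2)[OF assms(2)])

section \<open>The universal property: lifting bilinear maps\<close>

context
  fixes P :: "('k, 'c, 'p) module_scheme" and f
  assumes P: "module R P" and f: "f \<in> bilinear_maps R M N P"
begin

interpretation P: module R P by (rule P)

lemma free_lift_bilinear: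
  "free_lift R P (\<lambda>(x, y). f x y) \<in> linear_maps R free_prod P"
  "x \<in> carrier M \<Longrightarrow> y \<in> carrier N \<Longrightarrow> free_lift R P (\<lambda>(x, y). f x y) (free_gen R (x, y)) = f x y"
proof -
  have f': "(\<lambda>(x, y). f x y) \<in> carrier M \<times> carrier N \<rightarrow> carrier P"
    using linear_mapsD(1)[OF bilinear_mapsD(1)[OF f]] by auto
  show "free_lift R P (\<lambda>(x, y). f x y) \<in> linear_maps R free_prod P"
    by (rule P.free_lift_linear[OF f'])
  show "x \<in> carrier M \<Longrightarrow> y \<in> carrier N \<Longrightarrow> free_lift R P (\<lambda>(x, y). f x y) (free_gen R (x, y)) = f x y"
    using P.free_lift_gen[OF f'] by simp
qed

text \<open>The zero set of a linear map is a submodule, and bilinearity of \<open>f\<close> puts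
  every relator into it; minimality of \<open>kernel\<close> does the rest.\<close>

lemma free_lift_kernel:
  assumes "u \<in> kernel"
  shows "free_lift R P (\<lambda>(x, y). f x y) u = \<zero>\<^bsub>P\<^esub>"
proof -
  let ?L = "free_lift R P (\<lambda>(x, y). f x y)"
  note L = linear_mapsD[OF free_lift_bilinear(1)] linear_maps_minus[OF free_lift_bilinear(1) F.module_axioms P]
    and f1 = linear_mapsD[OF bilinear_mapsD(1)[OF f]] and f2 = linear_mapsD[OF bilinear_mapsD(2)[OF f]]
  have *: "x \<ominus>\<^bsub>P\<^esub> x = \<zero>\<^bsub>P\<^esub>" if "x \<in> carrier P" for x
    using that by (simp add: a_minus_def P.r_neg)
  have "kernel \<subseteq> {u \<in> carrier free_prod. ?L u = \<zero>\<^bsub>P\<^esub>}"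
  proof (rule kernel_least)
    show "submodule {u \<in> carrier free_prod. ?L u = \<zero>\<^bsub>P\<^esub>} R free_prod"
      by (rule linear_maps_kernel[OF free_lift_bilinear(1) F.module_axioms P])
    have "?L u = \<zero>\<^bsub>P\<^esub>" if "u \<in> tensor_relators R M N" for u
      using that unfolding tensor_relators_def Let_def
      by (auto simp: L gen_closed free_lift_bilinear(2) f1 f2 *)
    then show "tensor_relators R M N \<subseteq> {u \<in> carrier free_prod. ?L u = \<zero>\<^bsub>P\<^esub>}"
      using relators_closed by blast
  qed
  then show ?thesis using assms by blast
qed

text \<open>Independence of the choice: the representative that \<open>SOME\<close> picks differs
  from \<open>u\<close> by a kernel element, on which the free lift vanishes.\<close>

lemma tensor_lift_coset:
  assumes "u \<in> carrier free_prod"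
  shows "tensor_lift R P f (coset u) = free_lift R P (\<lambda>(x, y). f x y) u"
proof -
  let ?L = "free_lift R P (\<lambda>(x, y). f x y)"
  define v where "v = (SOME v. v \<in> coset u)"
  have v: "v \<in> coset u"
    unfolding v_def by (rule someI[of "\<lambda>v. v \<in> coset u"]) (rule K.a_rcos_self[OF assms])
  then have vc: "v \<in> carrier free_prod" by (rule K.a_elemrcos_carrier[OF assms])
  have "v \<ominus>\<^bsub>free_prod\<^esub> u \<in> kernel"
    using K.a_repr_independence'[OF v assms] coset_eq_iff[OF vc assms] by simp
  then have "?L v \<ominus>\<^bsub>P\<^esub> ?L u = \<zero>\<^bsub>P\<^esub>"
    using free_lift_kernel linear_maps_minus[OF free_lift_bilinear(1) F.module_axioms P vc assms] by simp
  \<comment> \<open>A vanishing difference becomes an equation by uniqueness of additive inverses: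
    \<open>?L v\<close> is the inverse of the inverse of \<open>?L u\<close>.\<close>
  then have "\<ominus>\<^bsub>P\<^esub> (\<ominus>\<^bsub>P\<^esub> ?L u) = ?L v"
    using linear_mapsD(1)[OF free_lift_bilinear(1)] vc assms
    by (intro P.minus_equality) (simp_all add: a_minus_def)
  then have "?L v = ?L u"
    using linear_mapsD(1)[OF free_lift_bilinear(1) assms] by simp
  then show ?thesis
    by (simp add: tensor_lift_eq_free_lift v_def)
qed

lemma tensor_lift_linear: "tensor_lift R P f \<in> linear_maps R (tensor R M N) P"
  by (rule linear_mapsI)
    (auto simp: carrier_tensor_module coset_add coset_smult tensor_lift_coset
      linear_mapsD[OF free_lift_bilinear(1)])

lemma tensor_lift_pure:
  "x \<in> carrier M \<Longrightarrow> y \<in> carrier N \<Longrightarrow> tensor_lift R P f (pure x y) = f x y"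
  by (simp add: pure_tensor_def tensor_lift_coset gen_closed free_lift_bilinear(2))

end

end

text \<open>From here on cosets are left behind, and the lemmas speak of \<open>tensor\<close>.
  Rewriting its fields to those of \<open>tensor_module\<close> would take goals out of the form
  these lemmas match.\<close>

declare tensor_sel [simp del]

text \<open>Lifting with a parameter \<open>z\<close>, for maps given as nested lifts. Linearity in
  \<open>z\<close> at a fixed tensor \<open>t\<close> follows by induction on \<open>t\<close>: for
  a pure tensor the lift is \<open>f x y z\<close>, and a sum of linear maps is linear.\<close>

lemma (in module_pair) tensor_lift_bilinear:
  assumes "module R P" "module R Q"
    and lin: "\<And>x y. x \<in> carrier M \<Longrightarrow> y \<in> carrier N \<Longrightarrow> f x y \<in> linear_maps R Q P"
    and bil: "\<And>z. z \<in> carrier Q \<Longrightarrow> (\<lambda>x y. f x y z) \<in> bilinear_maps R M N P"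
  shows "(\<lambda>t z. tensor_lift R P (\<lambda>x y. f x y z) t) \<in> bilinear_maps R (tensor R M N) Q P"
proof (rule bilinear_mapsI)
  note L = tensor_lift_linear[OF assms(1) bil]
  show "tensor_lift R P (\<lambda>x y. f x y z) \<in> linear_maps R (tensor R M N) P" if "z \<in> carrier Q" for z
    by (rule L[OF that])
  show "(\<lambda>z. tensor_lift R P (\<lambda>x y. f x y z) t) \<in> linear_maps R Q P"
    if "t \<in> carrier (tensor R M N)" for t
    using that
  proof (induction t rule: tensor_induct)
    case (pure x y)
    show ?case
      by (rule linear_maps_cong[OF lin[OF pure] assms(2)]) (rule tensor_lift_pure[OF assms(1) bil pure])
  next
    case (add s t)
    show ?case
      by (rule linear_maps_cong[OF linear_maps_add[OF add(3,4) assms(1)] assms(2)])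
        (rule linear_mapsD(2)[OF L add(1,2)])
  qed
qed

section \<open>Tensor products of linear maps, and the associator\<close>

lemma
  assumes "module R M" "module R N" "module R M'" "module R N'"
    and f: "f \<in> linear_maps R M M'" and g: "g \<in> linear_maps R N N'"
  shows tensor_map_linear: "tensor_map R M' N' f g \<in> linear_maps R (tensor R M N) (tensor R M' N')"
    and tensor_map_pure: "x \<in> carrier M \<Longrightarrow> y \<in> carrier N \<Longrightarrow>
      tensor_map R M' N' f g (pure_tensor R M N x y) = pure_tensor R M' N' (f x) (g y)"
proof -
  interpret MN: module_pair R M N using assms by (simp add: module_pair_def)
  interpret MN': module_pair R M' N' using assms by (simp add: module_pair_def)
  note b = bilinear_maps_precompose[OF MN'.pure_tensor_bilinear f g]
  show "tensor_map R M' N' f g \<in> linear_maps R (tensor R M N) (tensor R M' N')"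
    unfolding tensor_map_def by (rule MN.tensor_lift_linear[OF MN'.module_tensor b])
  show "x \<in> carrier M \<Longrightarrow> y \<in> carrier N \<Longrightarrow>
      tensor_map R M' N' f g (pure_tensor R M N x y) = pure_tensor R M' N' (f x) (g y)"
    unfolding tensor_map_def by (rule MN.tensor_lift_pure[OF MN'.module_tensor b])
qed

text \<open>For fixed \<open>z\<close> the inner lift is the tensor product of the identity with
  \<open>y \<mapsto> y \<otimes> z\<close>, which gives the value on \<open>s \<otimes> z\<close>
  for an arbitrary tensor \<open>s\<close>.\<close>

lemma
  assumes "module R L" "module R M" "module R N"
  shows tensor_assoc_linear: "tensor_assoc R L M N \<in>
      linear_maps R (tensor R (tensor R L M) N) (tensor R L (tensor R M N))"
    and tensor_assoc_pure: "s \<in> carrier (tensor R L M) \<Longrightarrow> z \<in> carrier N \<Longrightarrow>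
      tensor_assoc R L M N (pure_tensor R (tensor R L M) N s z) =
      tensor_map R L (tensor R M N) (\<lambda>x. x) (\<lambda>y. pure_tensor R M N y z) s"
proof -
  interpret LM: module_pair R L M using assms by (simp add: module_pair_def)
  interpret MN: module_pair R M N using assms by (simp add: module_pair_def)
  interpret L_MN: module_pair R L "tensor R M N"
    using assms MN.module_tensor by (simp add: module_pair_def)
  interpret LM_N: module_pair R "tensor R L M" N
    using assms LM.module_tensor by (simp add: module_pair_def)
  have b: "(\<lambda>s z. tensor_lift R (tensor R L (tensor R M N)) (\<lambda>x y. L_MN.pure x (MN.pure y z)) s)
      \<in> bilinear_maps R (tensor R L M) N (tensor R L (tensor R M N))"
  proof (rule LM.tensor_lift_bilinear[OF L_MN.module_tensor assms(3)])
    fix x y assume "x \<in> carrier L" "y \<in> carrier M"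
    then show "(\<lambda>z. L_MN.pure x (MN.pure y z)) \<in> linear_maps R N (tensor R L (tensor R M N))"
      by (intro linear_maps_comp[OF MN.pure_linear_right L_MN.pure_linear_right])
  next
    fix z assume "z \<in> carrier N"
    then show "(\<lambda>x y. L_MN.pure x (MN.pure y z)) \<in> bilinear_maps R L M (tensor R L (tensor R M N))"
      by (rule bilinear_maps_precompose[OF L_MN.pure_tensor_bilinear linear_maps_id MN.pure_linear_left])
  qed
  show "tensor_assoc R L M N \<in> linear_maps R (tensor R (tensor R L M) N) (tensor R L (tensor R M N))"
    unfolding tensor_assoc_def Let_def by (rule LM_N.tensor_lift_linear[OF L_MN.module_tensor b])
  show "s \<in> carrier (tensor R L M) \<Longrightarrow> z \<in> carrier N \<Longrightarrow>
      tensor_assoc R L M N (LM_N.pure s z) = tensor_map R L (tensor R M N) (\<lambda>x. x) (\<lambda>y. MN.pure y z) s"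
    unfolding tensor_assoc_def Let_def
    by (subst LM_N.tensor_lift_pure[OF L_MN.module_tensor b]) (simp_all add: tensor_map_def)
qed

lemma tensor_assoc_pure_pure:
  assumes "module R L" "module R M" "module R N"
    and "x \<in> carrier L" "y \<in> carrier M" "z \<in> carrier N"
  shows "tensor_assoc R L M N (pure_tensor R (tensor R L M) N (pure_tensor R L M x y) z) =
    pure_tensor R L (tensor R M N) x (pure_tensor R M N y z)"
proof -
  interpret LM: module_pair R L M using assms by (simp add: module_pair_def)
  interpret MN: module_pair R M N using assms by (simp add: module_pair_def)
  show ?thesis
    using assms tensor_assoc_pure[OF assms(1-3) LM.pure_closed]
      tensor_map_pure[OF assms(1,2,1) MN.module_tensor linear_maps_id MN.pure_linear_left]
    by simp
qed


section \<open>Tensor products of algebras\<close>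

context assoc_algebra
begin

lemma left_mult_linear: "a \<in> carrier A \<Longrightarrow> (\<lambda>x. a \<otimes>\<^bsub>A\<^esub> x) \<in> linear_maps R A A"
  by (rule linear_mapsI) (simp_all add: r_distr smult_mult_right)

lemma right_mult_linear: "a \<in> carrier A \<Longrightarrow> (\<lambda>x. x \<otimes>\<^bsub>A\<^esub> a) \<in> linear_maps R A A"
  by (rule linear_mapsI) (simp_all add: l_distr smult_mult_left)

end

locale algebra_pair = A: assoc_algebra R A + B: assoc_algebra R B
  for R :: "('k, 'r) ring_scheme" (structure)
    and A :: "('k, 'a, 'm) module_scheme" (structure)
    and B :: "('k, 'b, 'n) module_scheme" (structure)
begin

sublocale module_pair R A B
  by unfold_locales

abbreviation AB :: "('k, ('a \<times> 'b \<Rightarrow> 'k) set) module"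
  where "AB \<equiv> tensor R A B"

lemma tensor_mult_eq:
  "s \<otimes>\<^bsub>AB\<^esub> t = tensor_lift R AB (\<lambda>x y.
     tensor_lift R AB (\<lambda>x' y'. pure (x \<otimes>\<^bsub>A\<^esub> x') (y \<otimes>\<^bsub>B\<^esub> y')) t) s"
proof -
  have "s \<otimes>\<^bsub>AB\<^esub> t = tensor_lift R (tensor_module R A B) (\<lambda>x y.
      tensor_lift R (tensor_module R A B) (\<lambda>x' y'. pure (x \<otimes>\<^bsub>A\<^esub> x') (y \<otimes>\<^bsub>B\<^esub> y')) t) s"
    by (simp add: tensor_def Let_def)
  then show ?thesis by (simp add: tensor_lift_tensor)
qed

lemma pure_mult_bilinear:
  assumes "x \<in> carrier A" "y \<in> carrier B"
  shows "(\<lambda>x' y'. pure (x \<otimes>\<^bsub>A\<^esub> x') (y \<otimes>\<^bsub>B\<^esub> y')) \<in> bilinear_maps R A B AB"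
  by (rule bilinear_maps_precompose[OF pure_tensor_bilinear])
    (use assms A.left_mult_linear B.left_mult_linear in blast)+

text \<open>\<open>tensor_lift_bilinear\<close> admits one parameter at a time, so one of
  \<open>x\<close>, \<open>y\<close> is frozen while the other serves as the parameter.\<close>

lemma tensor_mult_inner_bilinear:
  assumes "t \<in> carrier AB"
  shows "(\<lambda>x y. tensor_lift R AB (\<lambda>x' y'. pure (x \<otimes>\<^bsub>A\<^esub> x') (y \<otimes>\<^bsub>B\<^esub> y')) t) \<in> bilinear_maps R A B AB"
proof (rule bilinear_mapsI)
  fix x assume x: "x \<in> carrier A"
  have "(\<lambda>t y. tensor_lift R AB (\<lambda>x' y'. pure (x \<otimes>\<^bsub>A\<^esub> x') (y \<otimes>\<^bsub>B\<^esub> y')) t) \<in> bilinear_maps R AB B AB"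
    by (rule tensor_lift_bilinear[OF module_tensor B.module_axioms])
      (use x in \<open>auto intro!: linear_maps_comp[OF B.right_mult_linear pure_linear_right] pure_mult_bilinear\<close>)
  from bilinear_mapsD(1)[OF this assms]
  show "(\<lambda>y. tensor_lift R AB (\<lambda>x' y'. pure (x \<otimes>\<^bsub>A\<^esub> x') (y \<otimes>\<^bsub>B\<^esub> y')) t) \<in> linear_maps R B AB" .
next
  fix y assume y: "y \<in> carrier B"
  have "(\<lambda>t x. tensor_lift R AB (\<lambda>x' y'. pure (x \<otimes>\<^bsub>A\<^esub> x') (y \<otimes>\<^bsub>B\<^esub> y')) t) \<in> bilinear_maps R AB A AB"
    by (rule tensor_lift_bilinear[OF module_tensor A.module_axioms])
      (use y in \<open>auto intro!: linear_maps_comp[OF A.right_mult_linear pure_linear_left] pure_mult_bilinear\<close>)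
  from bilinear_mapsD(1)[OF this assms]
  show "(\<lambda>x. tensor_lift R AB (\<lambda>x' y'. pure (x \<otimes>\<^bsub>A\<^esub> x') (y \<otimes>\<^bsub>B\<^esub> y')) t) \<in> linear_maps R A AB" .
qed

text \<open>Here the parameter of the outer lift is the entire right factor
  \<open>t\<close>.\<close>

lemma tensor_mult_bilinear: "(\<otimes>\<^bsub>AB\<^esub>) \<in> bilinear_maps R AB AB AB"
proof -
  have "(\<lambda>s t. tensor_lift R AB (\<lambda>x y. tensor_lift R AB (\<lambda>x' y'. pure (x \<otimes>\<^bsub>A\<^esub> x') (y \<otimes>\<^bsub>B\<^esub> y')) t) s)
    \<in> bilinear_maps R AB AB AB"
    by (rule tensor_lift_bilinear[OF module_tensor module_tensor])
      (auto intro: tensor_lift_linear[OF module_tensor pure_mult_bilinear] tensor_mult_inner_bilinear)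
  then show ?thesis
    by (simp flip: tensor_mult_eq)
qed

lemma tensor_mult_pure:
  assumes "x \<in> carrier A" "y \<in> carrier B" "x' \<in> carrier A" "y' \<in> carrier B"
  shows "pure x y \<otimes>\<^bsub>AB\<^esub> pure x' y' = pure (x \<otimes>\<^bsub>A\<^esub> x') (y \<otimes>\<^bsub>B\<^esub> y')"
proof -
  have "pure x y \<otimes>\<^bsub>AB\<^esub> pure x' y' =
      tensor_lift R AB (\<lambda>x' y'. pure (x \<otimes>\<^bsub>A\<^esub> x') (y \<otimes>\<^bsub>B\<^esub> y')) (pure x' y')"
    unfolding tensor_mult_eq
    by (rule tensor_lift_pure[OF module_tensor tensor_mult_inner_bilinear]) (use assms in auto)
  also have "\<dots> = pure (x \<otimes>\<^bsub>A\<^esub> x') (y \<otimes>\<^bsub>B\<^esub> y')"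
    by (rule tensor_lift_pure[OF module_tensor pure_mult_bilinear]) (use assms in auto)
  finally show ?thesis .
qed

lemma tensor_one: "\<one>\<^bsub>AB\<^esub> = pure \<one>\<^bsub>A\<^esub> \<one>\<^bsub>B\<^esub>"
  by (simp add: tensor_def Let_def)

lemma tensor_assoc_algebra: "assoc_algebra R AB"
proof -
  note r = linear_mapsD[OF bilinear_mapsD(1)[OF tensor_mult_bilinear]]
    and l = linear_mapsD[OF bilinear_mapsD(2)[OF tensor_mult_bilinear]]
  have one: "\<one>\<^bsub>AB\<^esub> \<in> carrier AB"
    unfolding tensor_one by (rule pure_closed) auto
  \<comment> \<open>Associativity takes three inductions, each releasing one argument from being
    pure: first the third factor, then the second, then the first.\<close>
  have pure_pure_assoc: "pure x y \<otimes>\<^bsub>AB\<^esub> pure x' y' \<otimes>\<^bsub>AB\<^esub> u = pure x y \<otimes>\<^bsub>AB\<^esub> (pure x' y' \<otimes>\<^bsub>AB\<^esub> u)"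
    if "x \<in> carrier A" "y \<in> carrier B" "x' \<in> carrier A" "y' \<in> carrier B" "u \<in> carrier AB"
    for x y x' y' u
    using that(5)
  proof (induction u rule: tensor_induct)
    case (pure a b)
    with that show ?case
      by (simp only: tensor_mult_pure A.m_closed B.m_closed A.m_assoc B.m_assoc)
  next
    case (add u v)
    with that show ?case
      by (simp only: r pure_closed)
  qed
  have pure_assoc: "pure x y \<otimes>\<^bsub>AB\<^esub> t \<otimes>\<^bsub>AB\<^esub> u = pure x y \<otimes>\<^bsub>AB\<^esub> (t \<otimes>\<^bsub>AB\<^esub> u)"
    if "x \<in> carrier A" "y \<in> carrier B" "t \<in> carrier AB" "u \<in> carrier AB" for x y t u
    using that(3)
  proof (induction t rule: tensor_induct)
    case (pure a b)
    with that show ?case by (simp only: pure_pure_assoc)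
  next
    case (add s t)
    with that show ?case by (simp only: r l pure_closed)
  qed
  have assoc: "s \<otimes>\<^bsub>AB\<^esub> t \<otimes>\<^bsub>AB\<^esub> u = s \<otimes>\<^bsub>AB\<^esub> (t \<otimes>\<^bsub>AB\<^esub> u)"
    if "s \<in> carrier AB" "t \<in> carrier AB" "u \<in> carrier AB" for s t u
    using that(1)
  proof (induction s rule: tensor_induct)
    case (pure a b)
    with that show ?case by (simp only: pure_assoc)
  next
    case (add s s')
    with that show ?case by (simp only: r l)
  qed
  have l_one: "\<one>\<^bsub>AB\<^esub> \<otimes>\<^bsub>AB\<^esub> t = t" if "t \<in> carrier AB" for t
    using that
  proof (induction t rule: tensor_induct)
    case (pure a b)
    then show ?case
      by (simp only: tensor_one tensor_mult_pure A.one_closed B.one_closed A.l_one B.l_one)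
  next
    case (add s t)
    then show ?case by (simp only: r one)
  qed
  have r_one: "t \<otimes>\<^bsub>AB\<^esub> \<one>\<^bsub>AB\<^esub> = t" if "t \<in> carrier AB" for t
    using that
  proof (induction t rule: tensor_induct)
    case (pure a b)
    then show ?case
      by (simp only: tensor_one tensor_mult_pure A.one_closed B.one_closed A.r_one B.r_one)
  next
    case (add s t)
    then show ?case by (simp only: l one)
  qed
  have "ring AB"
  proof (rule ringI)
    show "abelian_group AB" by (rule T.abelian_group_axioms)
    show "monoid AB"
      by (rule monoidI) (simp_all only: r one assoc l_one r_one)
  qed (simp_all only: l r)
  then show ?thesis
    using module_tensor by (intro assoc_algebra.intro assoc_algebra_axioms.intro) (simp_all only: l r)
qed

sublocale AB: assoc_algebra R AB
  by (rule tensor_assoc_algebra)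

text \<open>Both sides of the multiplicativity law are additive in each factor, so pure tensors
  decide: the right factor is released first, then the left.\<close>

lemma linear_map_ring_homI:
  assumes "assoc_algebra R C" and h: "h \<in> linear_maps R AB C"
    and mult: "\<And>x y x' y'. \<lbrakk>x \<in> carrier A; y \<in> carrier B; x' \<in> carrier A; y' \<in> carrier B\<rbrakk> \<Longrightarrow>
      h (pure (x \<otimes>\<^bsub>A\<^esub> x') (y \<otimes>\<^bsub>B\<^esub> y')) = h (pure x y) \<otimes>\<^bsub>C\<^esub> h (pure x' y')"
    and one: "h (pure \<one>\<^bsub>A\<^esub> \<one>\<^bsub>B\<^esub>) = \<one>\<^bsub>C\<^esub>"
  shows "h \<in> ring_hom AB C"
proof -
  interpret C: assoc_algebra R C by fact
  note h' = linear_mapsD[OF h]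
  have pure_mult: "h (pure x y \<otimes>\<^bsub>AB\<^esub> t) = h (pure x y) \<otimes>\<^bsub>C\<^esub> h t"
    if "x \<in> carrier A" "y \<in> carrier B" "t \<in> carrier AB" for x y t
    using that(3)
  proof (induction t rule: tensor_induct)
    case (pure a b)
    with that show ?case by (simp only: mult tensor_mult_pure)
  next
    case (add s t)
    with that show ?case
      by (simp only: AB.r_distr C.r_distr h' pure_closed AB.m_closed)
  qed
  have "h (s \<otimes>\<^bsub>AB\<^esub> t) = h s \<otimes>\<^bsub>C\<^esub> h t" if "s \<in> carrier AB" "t \<in> carrier AB" for s t
    using that(1)
  proof (induction s rule: tensor_induct)
    case (pure a b)
    with that show ?case by (simp only: pure_mult)
  next
    case (add s s')
    with that show ?case
      by (simp only: AB.l_distr C.l_distr h' AB.m_closed)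
  qed
  then show ?thesis
    by (intro ring_hom_memI) (simp_all only: h' one tensor_one)
qed

end

lemma tensor_map_ring_hom:
  assumes "assoc_algebra R A" "assoc_algebra R B" "assoc_algebra R A'" "assoc_algebra R B'"
    and f: "f \<in> linear_maps R A A'" "f \<in> ring_hom A A'"
    and g: "g \<in> linear_maps R B B'" "g \<in> ring_hom B B'"
  shows "tensor_map R A' B' f g \<in> ring_hom (tensor R A B) (tensor R A' B')"
proof -
  interpret P: algebra_pair R A B using assms by (simp add: algebra_pair_def)
  interpret P': algebra_pair R A' B' using assms by (simp add: algebra_pair_def)
  note m = P.A.module_axioms P.B.module_axioms P'.A.module_axioms P'.B.module_axioms
  note f' = ring_hom_memE[OF f(2)] and g' = ring_hom_memE[OF g(2)]
  show ?thesis
  proof (rule P.linear_map_ring_homI[OF P'.tensor_assoc_algebra tensor_map_linear[OF m f(1) g(1)]])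
  qed (simp_all only: tensor_map_pure[OF m f(1) g(1)] P'.tensor_mult_pure f' g' P'.tensor_one
      P.A.m_closed P.B.m_closed P.A.one_closed P.B.one_closed)
qed

text \<open>A pure tensor of \<open>(A \<otimes> B) \<otimes> C\<close> still carries an arbitrary
  tensor of \<open>A \<otimes> B\<close> in its first slot. \<open>linear_map_ring_homI\<close>
  therefore leaves two further inductions, over these first slots, before everything is a pure
  triple on which both products are computed slotwise.\<close>

lemma tensor_assoc_ring_hom:
  assumes "assoc_algebra R A" "assoc_algebra R B" "assoc_algebra R C"
  shows "tensor_assoc R A B C \<in> ring_hom (tensor R (tensor R A B) C) (tensor R A (tensor R B C))"
proof -
  interpret AB: algebra_pair R A B using assms by (simp add: algebra_pair_def)
  interpret BC: algebra_pair R B C using assms by (simp add: algebra_pair_def)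
  interpret A_BC: algebra_pair R A "tensor R B C"
    using assms BC.tensor_assoc_algebra by (simp add: algebra_pair_def)
  interpret AB_C: algebra_pair R "tensor R A B" C
    using assms AB.tensor_assoc_algebra by (simp add: algebra_pair_def)
  note m = AB.A.module_axioms AB.B.module_axioms BC.B.module_axioms
  let ?h = "\<lambda>s z. tensor_assoc R A B C (AB_C.pure s z)"
  let ?T = "tensor R A (tensor R B C)"
  note assoc_pure = tensor_assoc_pure_pure[OF m]
  have lin: "(\<lambda>s. ?h s z) \<in> linear_maps R AB.AB ?T" if "z \<in> carrier C" for z
    by (rule linear_maps_comp[OF AB_C.pure_linear_left[OF that] tensor_assoc_linear[OF m]])
  note h = linear_mapsD[OF lin]
  have pure_mult: "?h (AB.pure x y \<otimes>\<^bsub>AB.AB\<^esub> t) (z \<otimes>\<^bsub>C\<^esub> z') = ?h (AB.pure x y) z \<otimes>\<^bsub>?T\<^esub> ?h t z'"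
    if "x \<in> carrier A" "y \<in> carrier B" "z \<in> carrier C" "z' \<in> carrier C" "t \<in> carrier AB.AB"
    for x y z z' t
    using that(5)
  proof (induction t rule: AB.tensor_induct)
    case (pure a b)
    with that show ?case
      by (simp only: AB.tensor_mult_pure assoc_pure A_BC.tensor_mult_pure BC.tensor_mult_pure
          AB.A.m_closed AB.B.m_closed BC.B.m_closed BC.pure_closed)
  next
    case (add s t)
    with that show ?case
      by (simp only: AB.AB.r_distr A_BC.AB.r_distr h AB.pure_closed AB.AB.m_closed BC.B.m_closed)
  qed
  have mult: "?h (s \<otimes>\<^bsub>AB.AB\<^esub> t) (z \<otimes>\<^bsub>C\<^esub> z') = ?h s z \<otimes>\<^bsub>?T\<^esub> ?h t z'"
    if "s \<in> carrier AB.AB" "t \<in> carrier AB.AB" "z \<in> carrier C" "z' \<in> carrier C" for s t z z'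
    using that(1)
  proof (induction s rule: AB.tensor_induct)
    case (pure a b)
    with that show ?case by (simp only: pure_mult)
  next
    case (add s s')
    with that show ?case
      by (simp only: AB.AB.l_distr A_BC.AB.l_distr h AB.AB.m_closed BC.B.m_closed)
  qed
  show ?thesis
    by (rule AB_C.linear_map_ring_homI[OF A_BC.tensor_assoc_algebra tensor_assoc_linear[OF m]])
      (simp_all only: mult AB.tensor_one BC.tensor_one A_BC.tensor_one assoc_pure
        AB.A.one_closed AB.B.one_closed BC.B.one_closed)
qed

section \<open>Twists\<close>

context hopf_algebra
begin

abbreviation HH where "HH \<equiv> tensor R H H"

sublocale HH: algebra_pair R H H
  by (simp add: algebra_pair_def assoc_algebra_axioms)

sublocale HH_H: algebra_pair R HH H
  by (simp add: algebra_pair_def assoc_algebra_axioms HH.tensor_assoc_algebra)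

sublocale H_HH: algebra_pair R H HH
  by (simp add: algebra_pair_def assoc_algebra_axioms HH.tensor_assoc_algebra)

text \<open>\<open>mods(1)\<close> is the module structure of \<open>H\<close> and
  \<open>mods(2)\<close> that of \<open>HH\<close>. A selection such as \<open>mods(1,1,2,1)\<close>
  lists the two sources and then the two targets of a tensor map.\<close>

lemmas comult_hom = ring_hom_memE[OF comult_ring_hom]
  and counit_hom = ring_hom_memE[OF counit_ring_hom]
  and mods = module_axioms HH.module_tensor

section \<open>Applying the twisted coproduct in one tensor factor\<close>

lemma left_mult_comult_linear:
  assumes "F \<in> carrier HH"
  shows "(\<lambda>a. F \<otimes>\<^bsub>HH\<^esub> \<Delta> a) \<in> linear_maps R H HH"
  by (rule linear_maps_comp[OF comult_linear HH.AB.left_mult_linear[OF assms]])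

text \<open>Left multiplication by \<open>F \<otimes> 1\<close> acts slotwise on
  \<open>\<Delta> x \<otimes> y\<close>: it produces \<open>F \<Delta> x\<close> in the first slot
  and keeps \<open>y\<close> in the second.\<close>

lemma tensor_map_twisted_left:
  assumes F: "F \<in> carrier HH" and t: "t \<in> carrier HH"
  shows "tensor_map R HH H (\<lambda>a. F \<otimes>\<^bsub>HH\<^esub> \<Delta> a) (\<lambda>x. x) t =
    HH_H.pure F \<one>\<^bsub>H\<^esub> \<otimes>\<^bsub>tensor R HH H\<^esub> tensor_map R HH H \<Delta> (\<lambda>x. x) t"
proof (rule HH.linear_maps_eqI[OF _ _ _ t])
  note m = mods(1,1,2,1)
  note d = left_mult_comult_linear[OF F]
  show "tensor_map R HH H (\<lambda>a. F \<otimes>\<^bsub>HH\<^esub> \<Delta> a) (\<lambda>x. x) \<in> linear_maps R HH (tensor R HH H)"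
    by (rule tensor_map_linear[OF m d linear_maps_id])
  show "(\<lambda>t. HH_H.pure F \<one>\<^bsub>H\<^esub> \<otimes>\<^bsub>tensor R HH H\<^esub> tensor_map R HH H \<Delta> (\<lambda>x. x) t) \<in> linear_maps R HH (tensor R HH H)"
    by (rule linear_maps_comp[OF tensor_map_linear[OF m comult_linear linear_maps_id] HH_H.AB.left_mult_linear])
      (use F in simp)
  show "tensor_map R HH H (\<lambda>a. F \<otimes>\<^bsub>HH\<^esub> \<Delta> a) (\<lambda>x. x) (HH.pure x y) =
    HH_H.pure F \<one>\<^bsub>H\<^esub> \<otimes>\<^bsub>tensor R HH H\<^esub> tensor_map R HH H \<Delta> (\<lambda>x. x) (HH.pure x y)"
    if "x \<in> carrier H" "y \<in> carrier H" for x y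
    using that F comult_hom(1)
    by (simp add: tensor_map_pure[OF m d linear_maps_id] tensor_map_pure[OF m comult_linear linear_maps_id]
        HH_H.tensor_mult_pure)
qed

lemma tensor_map_twisted_right:
  assumes F: "F \<in> carrier HH" and t: "t \<in> carrier HH"
  shows "tensor_map R H HH (\<lambda>x. x) (\<lambda>a. F \<otimes>\<^bsub>HH\<^esub> \<Delta> a) t =
    H_HH.pure \<one>\<^bsub>H\<^esub> F \<otimes>\<^bsub>tensor R H HH\<^esub> tensor_map R H HH (\<lambda>x. x) \<Delta> t"
proof (rule HH.linear_maps_eqI[OF _ _ _ t])
  note m = mods(1,1,1,2)
  note d = left_mult_comult_linear[OF F]
  show "tensor_map R H HH (\<lambda>x. x) (\<lambda>a. F \<otimes>\<^bsub>HH\<^esub> \<Delta> a) \<in> linear_maps R HH (tensor R H HH)"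
    by (rule tensor_map_linear[OF m linear_maps_id d])
  show "(\<lambda>t. H_HH.pure \<one>\<^bsub>H\<^esub> F \<otimes>\<^bsub>tensor R H HH\<^esub> tensor_map R H HH (\<lambda>x. x) \<Delta> t) \<in> linear_maps R HH (tensor R H HH)"
    by (rule linear_maps_comp[OF tensor_map_linear[OF m linear_maps_id comult_linear] H_HH.AB.left_mult_linear])
      (use F in simp)
  show "tensor_map R H HH (\<lambda>x. x) (\<lambda>a. F \<otimes>\<^bsub>HH\<^esub> \<Delta> a) (HH.pure x y) =
    H_HH.pure \<one>\<^bsub>H\<^esub> F \<otimes>\<^bsub>tensor R H HH\<^esub> tensor_map R H HH (\<lambda>x. x) \<Delta> (HH.pure x y)"
    if "x \<in> carrier H" "y \<in> carrier H" for x y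
    using that F comult_hom(1)
    by (simp add: tensor_map_pure[OF m linear_maps_id d] tensor_map_pure[OF m linear_maps_id comult_linear]
        H_HH.tensor_mult_pure)
qed

section \<open>The counit applied in one tensor factor\<close>

lemma counit_one_linear: "(\<lambda>x. \<epsilon> x \<odot>\<^bsub>H\<^esub> \<one>\<^bsub>H\<^esub>) \<in> linear_maps R H H"
  by (rule linear_mapsI)
    (simp_all add: counit_hom counit_smult smult_l_distr smult_assoc1)

text \<open>The counit followed by the embedding of the field as multiples of the unit, a composite
  of ring homomorphisms. This is what makes \<open>counit_id\<close> and \<open>id_counit\<close>
  multiplicative.\<close>

lemma counit_one_ring_hom: "(\<lambda>x. \<epsilon> x \<odot>\<^bsub>H\<^esub> \<one>\<^bsub>H\<^esub>) \<in> ring_hom H H"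
  by (rule ring_hom_memI)
    (simp_all add: counit_hom smult_l_distr smult_assoc1 smult_mult_left)

lemma id_ring_hom: "(\<lambda>x. x) \<in> ring_hom H H"
  by (rule ring_hom_memI) simp_all

lemma
  shows counit_id_linear: "counit_id R H \<epsilon> \<in> linear_maps R HH HH"
    and id_counit_linear: "id_counit R H \<epsilon> \<in> linear_maps R HH HH"
    and counit_id_pure: "x \<in> carrier H \<Longrightarrow> y \<in> carrier H \<Longrightarrow>
      counit_id R H \<epsilon> (HH.pure x y) = HH.pure (\<epsilon> x \<odot>\<^bsub>H\<^esub> \<one>\<^bsub>H\<^esub>) y"
    and id_counit_pure: "x \<in> carrier H \<Longrightarrow> y \<in> carrier H \<Longrightarrow>
      id_counit R H \<epsilon> (HH.pure x y) = HH.pure x (\<epsilon> y \<odot>\<^bsub>H\<^esub> \<one>\<^bsub>H\<^esub>)"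
  unfolding counit_id_def id_counit_def
  by (rule tensor_map_linear[OF mods(1,1,1,1) counit_one_linear linear_maps_id]
      tensor_map_linear[OF mods(1,1,1,1) linear_maps_id counit_one_linear]
      tensor_map_pure[OF mods(1,1,1,1) counit_one_linear linear_maps_id]
      tensor_map_pure[OF mods(1,1,1,1) linear_maps_id counit_one_linear]; assumption)+

lemma
  shows counit_id_ring_hom: "counit_id R H \<epsilon> \<in> ring_hom HH HH"
    and id_counit_ring_hom: "id_counit R H \<epsilon> \<in> ring_hom HH HH"
  unfolding counit_id_def id_counit_def
  by (rule tensor_map_ring_hom[OF assoc_algebra_axioms assoc_algebra_axioms assoc_algebra_axioms assoc_algebra_axioms];
      rule counit_one_linear counit_one_ring_hom id_ring_hom linear_maps_id)+

text \<open>The counit axiom takes values in \<open>H\<close>, while \<open>counit_id\<close> stays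
  in \<open>HH\<close>. The bridge is that \<open>counit_id t\<close> is the unit tensored with the
  lift from the axiom, for every tensor \<open>t\<close>; on \<open>x \<otimes> y\<close> this just
  moves the scalar \<open>\<epsilon> x\<close> across the tensor sign.\<close>

lemma counit_id_comult:
  assumes "a \<in> carrier H"
  shows "counit_id R H \<epsilon> (\<Delta> a) = HH.pure \<one>\<^bsub>H\<^esub> a"
proof -
  have b: "(\<lambda>x y. \<epsilon> x \<odot>\<^bsub>H\<^esub> y) \<in> bilinear_maps R H H H"
    by (intro bilinear_mapsI linear_mapsI)
      (simp_all add: counit_hom counit_smult smult_l_distr smult_r_distr smult_assoc1 m_comm
        flip: smult_assoc1)
  note L = HH.tensor_lift_linear[OF mods(1) b]
  have "counit_id R H \<epsilon> t = HH.pure \<one>\<^bsub>H\<^esub> (tensor_lift R H (\<lambda>x y. \<epsilon> x \<odot>\<^bsub>H\<^esub> y) t)"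
    if "t \<in> carrier HH" for t
  proof (rule HH.linear_maps_eqI[OF counit_id_linear _ _ that])
    show "(\<lambda>t. HH.pure \<one>\<^bsub>H\<^esub> (tensor_lift R H (\<lambda>x y. \<epsilon> x \<odot>\<^bsub>H\<^esub> y) t)) \<in> linear_maps R HH HH"
      by (rule linear_maps_comp[OF L HH.pure_linear_right]) simp
    show "counit_id R H \<epsilon> (HH.pure x y) =
        HH.pure \<one>\<^bsub>H\<^esub> (tensor_lift R H (\<lambda>x y. \<epsilon> x \<odot>\<^bsub>H\<^esub> y) (HH.pure x y))"
      if "x \<in> carrier H" "y \<in> carrier H" for x y
      using that by (simp add: counit_id_pure HH.tensor_lift_pure[OF mods(1) b] counit_hom
          linear_mapsD(3)[OF HH.pure_linear_right] linear_mapsD(3)[OF HH.pure_linear_left])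
  qed
  from this[OF comult_hom(1)[OF assms]] counit_left[OF assms] show ?thesis by simp
qed

lemma id_counit_comult:
  assumes "a \<in> carrier H"
  shows "id_counit R H \<epsilon> (\<Delta> a) = HH.pure a \<one>\<^bsub>H\<^esub>"
proof -
  have b: "(\<lambda>x y. \<epsilon> y \<odot>\<^bsub>H\<^esub> x) \<in> bilinear_maps R H H H"
    by (intro bilinear_mapsI linear_mapsI)
      (simp_all add: counit_hom counit_smult smult_l_distr smult_r_distr smult_assoc1 m_comm
        flip: smult_assoc1)
  note L = HH.tensor_lift_linear[OF mods(1) b]
  have "id_counit R H \<epsilon> t = HH.pure (tensor_lift R H (\<lambda>x y. \<epsilon> y \<odot>\<^bsub>H\<^esub> x) t) \<one>\<^bsub>H\<^esub>"
    if "t \<in> carrier HH" for t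
  proof (rule HH.linear_maps_eqI[OF id_counit_linear _ _ that])
    show "(\<lambda>t. HH.pure (tensor_lift R H (\<lambda>x y. \<epsilon> y \<odot>\<^bsub>H\<^esub> x) t) \<one>\<^bsub>H\<^esub>) \<in> linear_maps R HH HH"
      by (rule linear_maps_comp[OF L HH.pure_linear_left]) simp
    show "id_counit R H \<epsilon> (HH.pure x y) =
        HH.pure (tensor_lift R H (\<lambda>x y. \<epsilon> y \<odot>\<^bsub>H\<^esub> x) (HH.pure x y)) \<one>\<^bsub>H\<^esub>"
      if "x \<in> carrier H" "y \<in> carrier H" for x y
      using that by (simp add: id_counit_pure HH.tensor_lift_pure[OF mods(1) b] counit_hom
          linear_mapsD(3)[OF HH.pure_linear_right] linear_mapsD(3)[OF HH.pure_linear_left])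
  qed
  from this[OF comult_hom(1)[OF assms]] counit_right[OF assms] show ?thesis by simp
qed

section \<open>The two directions of the correspondence\<close>

lemma twist_imp_twisted_coproduct:
  assumes "is_twist R H \<Delta> \<epsilon> F"
  shows "twisted_coproduct_conditions R H \<Delta> \<epsilon> (\<lambda>a. F \<otimes>\<^bsub>HH\<^esub> \<Delta> a)"
proof -
  let ?D1 = "tensor_map R HH H \<Delta> (\<lambda>x. x)" and ?D2 = "tensor_map R H HH (\<lambda>x. x) \<Delta>"
  let ?F12 = "HH_H.pure F \<one>\<^bsub>H\<^esub>" and ?F23 = "H_HH.pure \<one>\<^bsub>H\<^esub> F"
  let ?assoc = "tensor_assoc R H H H"
  have F: "F \<in> carrier HH"
    and cocycle: "?assoc (?F12 \<otimes>\<^bsub>tensor R HH H\<^esub> ?D1 F) = ?F23 \<otimes>\<^bsub>tensor R H HH\<^esub> ?D2 F"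
    and norm: "counit_id R H \<epsilon> F = \<one>\<^bsub>HH\<^esub>" "id_counit R H \<epsilon> F = \<one>\<^bsub>HH\<^esub>"
    using assms by (simp_all add: is_twist_def Let_def HH.tensor_one)
  note D1 = ring_hom_memE[OF tensor_map_ring_hom[OF assoc_algebra_axioms assoc_algebra_axioms
        HH.tensor_assoc_algebra assoc_algebra_axioms comult_linear comult_ring_hom linear_maps_id id_ring_hom]]
  note D2 = ring_hom_memE[OF tensor_map_ring_hom[OF assoc_algebra_axioms assoc_algebra_axioms
        assoc_algebra_axioms HH.tensor_assoc_algebra linear_maps_id id_ring_hom comult_linear comult_ring_hom]]
  note assoc = ring_hom_memE[OF tensor_assoc_ring_hom[OF assoc_algebra_axioms assoc_algebra_axioms assoc_algebra_axioms]]
  note counits = ring_hom_memE(2)[OF counit_id_ring_hom] ring_hom_memE(2)[OF id_counit_ring_hom]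
  have "?assoc (tensor_map R HH H (\<lambda>a. F \<otimes>\<^bsub>HH\<^esub> \<Delta> a) (\<lambda>x. x) (F \<otimes>\<^bsub>HH\<^esub> \<Delta> a)) =
      tensor_map R H HH (\<lambda>x. x) (\<lambda>a. F \<otimes>\<^bsub>HH\<^esub> \<Delta> a) (F \<otimes>\<^bsub>HH\<^esub> \<Delta> a)"
    if a: "a \<in> carrier H" for a
  proof -
    have \<Delta>a: "\<Delta> a \<in> carrier HH" and cl: "?F12 \<in> carrier (tensor R HH H)" "?F23 \<in> carrier (tensor R H HH)"
      using comult_hom(1)[OF a] F by simp_all
    have coassoc: "?assoc (?D1 (\<Delta> a)) = ?D2 (\<Delta> a)"
      using comult_coassoc a by (simp add: coassociative_def)
    have "?assoc (tensor_map R HH H (\<lambda>a. F \<otimes>\<^bsub>HH\<^esub> \<Delta> a) (\<lambda>x. x) (F \<otimes>\<^bsub>HH\<^esub> \<Delta> a)) =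
        ?assoc (?F12 \<otimes>\<^bsub>tensor R HH H\<^esub> ?D1 F \<otimes>\<^bsub>tensor R HH H\<^esub> ?D1 (\<Delta> a))"
      using F \<Delta>a cl by (simp add: tensor_map_twisted_left D1 HH_H.AB.m_assoc)
    \<comment> \<open>The associator is pushed through the product; the cocycle condition converts
      the left block, and coassociativity of \<Delta> converts the remaining factor.\<close>
    also have "\<dots> = ?F23 \<otimes>\<^bsub>tensor R H HH\<^esub> ?D2 F \<otimes>\<^bsub>tensor R H HH\<^esub> ?D2 (\<Delta> a)"
      using F \<Delta>a cl by (simp add: assoc(2) D1 coassoc cocycle)
    also have "\<dots> = tensor_map R H HH (\<lambda>x. x) (\<lambda>a. F \<otimes>\<^bsub>HH\<^esub> \<Delta> a) (F \<otimes>\<^bsub>HH\<^esub> \<Delta> a)"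
      using F \<Delta>a cl by (simp add: tensor_map_twisted_right D2 H_HH.AB.m_assoc)
    finally show ?thesis .
  qed
  \<comment> \<open>Condition (b) is multiplicativity of \<Delta> followed by reassociation. In (c),
    the image of \<open>F\<close> is the unit, which leaves the counit law for
    \<open>\<Delta> a\<close>.\<close>
  then show ?thesis
    using F by (simp add: twisted_coproduct_conditions_def coassociative_def comult_hom HH.AB.m_assoc
        counits norm counit_id_comult id_counit_comult)
qed

lemma twisted_coproduct_imp_twist:
  assumes d: "d \<in> linear_maps R H HH" and "twisted_coproduct_conditions R H \<Delta> \<epsilon> d"
  shows "is_twist R H \<Delta> \<epsilon> (d \<one>\<^bsub>H\<^esub>)"
proof -
  let ?F = "d \<one>\<^bsub>H\<^esub>"
  let ?d = "\<lambda>a. ?F \<otimes>\<^bsub>HH\<^esub> \<Delta> a"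
  have coassoc: "tensor_assoc R H H H (tensor_map R HH H d (\<lambda>x. x) ?F) = tensor_map R H HH (\<lambda>x. x) d ?F"
    and mult: "\<And>a b. a \<in> carrier H \<Longrightarrow> b \<in> carrier H \<Longrightarrow> d (a \<otimes>\<^bsub>H\<^esub> b) = d a \<otimes>\<^bsub>HH\<^esub> \<Delta> b"
    and norm: "counit_id R H \<epsilon> ?F = HH.pure \<one>\<^bsub>H\<^esub> \<one>\<^bsub>H\<^esub>" "id_counit R H \<epsilon> ?F = HH.pure \<one>\<^bsub>H\<^esub> \<one>\<^bsub>H\<^esub>"
    using assms(2) by (simp_all add: twisted_coproduct_conditions_def coassociative_def)
  have F: "?F \<in> carrier HH"
    by (rule linear_mapsD(1)[OF d]) simp
  note d' = left_mult_comult_linear[OF F]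
  have d_eq: "d a = ?d a" if "a \<in> carrier H" for a
    using mult[of "\<one>\<^bsub>H\<^esub>" a] that by simp
  \<comment> \<open>\<open>d\<close> and \<open>?d\<close> are known to agree only on
    \<open>carrier H\<close>, so they cannot be exchanged as functions; the two tensor maps are
    compared on pure tensors instead.\<close>
  have "tensor_map R HH H d (\<lambda>x. x) ?F = tensor_map R HH H ?d (\<lambda>x. x) ?F"
    by (rule HH.linear_maps_eqI[OF tensor_map_linear[OF mods(1,1,2,1) d linear_maps_id]
          tensor_map_linear[OF mods(1,1,2,1) d' linear_maps_id] _ F])
      (simp only: tensor_map_pure[OF mods(1,1,2,1) d linear_maps_id]
        tensor_map_pure[OF mods(1,1,2,1) d' linear_maps_id] d_eq)
  moreover have "tensor_map R H HH (\<lambda>x. x) d ?F = tensor_map R H HH (\<lambda>x. x) ?d ?F"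
    by (rule HH.linear_maps_eqI[OF tensor_map_linear[OF mods(1,1,1,2) linear_maps_id d]
          tensor_map_linear[OF mods(1,1,1,2) linear_maps_id d'] _ F])
      (simp only: tensor_map_pure[OF mods(1,1,1,2) linear_maps_id d]
        tensor_map_pure[OF mods(1,1,1,2) linear_maps_id d'] d_eq)
  ultimately show ?thesis
    using coassoc F norm
    by (simp add: is_twist_def Let_def tensor_map_twisted_left tensor_map_twisted_right)
qed

end

theorem lemma2p1:
  fixes k :: "('k, 'r) ring_scheme"
    and H :: "('k, 'a, 'h) module_scheme"
    and \<Delta> :: "'a \<Rightarrow> ('a \<times> 'a \<Rightarrow> 'k) set"
    and \<epsilon> :: "'a \<Rightarrow> 'k"
    and S :: "'a \<Rightarrow> 'a"
  assumes "hopf_algebra k H \<Delta> \<epsilon> S"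
  shows "(\<forall>F. is_twist k H \<Delta> \<epsilon> F \<longrightarrow>
            (\<lambda>a. F \<otimes>\<^bsub>tensor k H H\<^esub> \<Delta> a) \<in> linear_maps k H (tensor k H H) \<and>
            twisted_coproduct_conditions k H \<Delta> \<epsilon> (\<lambda>a. F \<otimes>\<^bsub>tensor k H H\<^esub> \<Delta> a)) \<and>
         (\<forall>d. d \<in> linear_maps k H (tensor k H H) \<and>
            twisted_coproduct_conditions k H \<Delta> \<epsilon> d \<longrightarrow>
            is_twist k H \<Delta> \<epsilon> (d \<one>\<^bsub>H\<^esub>))"
proof -
  interpret hopf_algebra k H \<Delta> \<epsilon> S by fact
  \<comment> \<open>Unfolding \<open>is_twist\<close> supplies the membership of \<open>F\<close> in
    the tensor square from which linearity of the twisted coproduct follows.\<close>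
  show ?thesis
    using left_mult_comult_linear twist_imp_twisted_coproduct twisted_coproduct_imp_twist
    by (auto simp: is_twist_def Let_def)
qed

end
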